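(* Let $I\subset\mathbb R\setminus\{0\}$ be an open interval, $f:I\to\mathbb R$ smooth with $f'^2>1$ and $f''\neq0$ everywhere on $I$, and let $C_1\neq0$ be a real constant. Put $$\mathfrak m=\frac{2f''\left(f'(f'^2-1)^2-s(2f'^2+1)f''\right)+s(f'^2-1)f'f'''}{s^3(f'^2-1)^4},$$ $$\mathfrak n=\frac{s(f'^2-1)f'f'''-\left(2f'(f'^2-1)+s(3f'^2+2)f''\right)f''}{C_1s^3(f'^2-1)^{7/2}},$$ and assume that $\mathfrak m$ and $\mathfrak n$ are non-zero functions. Then the rotational hypersurface $\Gamma^t(s,t,w)=(f(s),\ -s\cos t\sin w,\ -s\sin t,\ s\cos t\cos w)$ in $\mathbb E_1^4$ with Gauss map $N^t=\frac1{\sqrt{f'^2-1}}(1,\ -f'\cos t\sin w,\ -f'\sin t,\ f'\cos t\cos w)$ has generalized $L_2$ 1-type Gauss map; namely $L_2N^t=\mathfrak mN^t+\mathfrak nC$ with $C=(C_1,0,0,0)$.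
   Context: $\mathbb E_1^4$ is $\mathbb R^4$ with the Lorentzian metric $\langle\,,\rangle=-dx_1^2+dx_2^2+dx_3^2+dx_4^2$. Let $M$ be an oriented hypersurface of $\mathbb E_1^4$ with nondegenerate induced metric $g$, unit normal vector field (Gauss map) $N$, $\varepsilon=\langle N,N\rangle=\pm1$, shape operator $S=-dN$ and principal curvatures $\kappa_1,\kappa_2,\kappa_3$. Put $a_0=1$, $a_1=-(\kappa_1+\kappa_2+\kappa_3)$, $a_2=\kappa_1\kappa_2+\kappa_1\kappa_3+\kappa_2\kappa_3$, $a_3=-\kappa_1\kappa_2\kappa_3$. The Newton transformations are $P_0=I$, $P_k=a_kI+S\circ P_{k-1}$, and $L_k(\varphi)=\mathrm{tr}(P_k\circ\nabla^2\varphi)$ for $\varphi\in C^\infty(M)$, where $\nabla^2\varphi$ is the Hessian operator of $\varphi$ with respect to $g$; $L_k$ acts componentwise on $\mathbb R^4$-valued functions such as $N$. With $n=3$, $\binom{n}{k}H_k=(-\varepsilon)^ka_k$ and $C_k=\binom{n}{k+1}(-\varepsilon)^k$, the known formula used for the Gauss map is $L_kN=-\varepsilon C_k\big(\nabla H_{k+1}+(nH_1H_{k+1}-(n-k-1)H_{k+2})N\big)$, where $\nabla$ is the gradient of $g$ (for $k=2$ the last term has coefficient $0$). $M$ has generalized $L_k$ 1-type Gauss map if $L_kN=\mathfrak mN+\mathfrak nC$ for non-zero (i.e. not identically zero) smooth functions $\mathfrak m,\mathfrak n$ on $M$ and a non-zero constant vector $C\in\mathbb E_1^4$. Primes denote $d/ds$;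 $s\in I$, $0\le t,w\le2\pi$, and the parametrization is considered where it is an immersion ($\cos t\neq0$). *)

theory Defs
  imports "HOL-Analysis.Analysis"
begin

primrec Ck_on :: "nat \<Rightarrow> 'a::real_normed_vector set \<Rightarrow> ('a \<Rightarrow> 'b::real_normed_vector) \<Rightarrow> bool" where
  "Ck_on 0 U f \<longleftrightarrow> continuous_on U f"
| "Ck_on (Suc k) U f \<longleftrightarrow>
     (\<forall>x\<in>U. f differentiable (at x)) \<and> (\<forall>v. Ck_on k U (\<lambda>x. frechet_derivative f (at x) v))"

text \<open>Only used for open sets \<open>U\<close>.\<close>

definition smooth_on :: "'a::real_normed_vector set \<Rightarrow> ('a \<Rightarrow> 'b::real_normed_vector) \<Rightarrow> bool" where
  "smooth_on U f \<longleftrightarrow> (\<forall>k. Ck_on k U f)"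

definition lorentz :: "real^4 \<Rightarrow> real^4 \<Rightarrow> real" where
  "lorentz x y = - (x $ 1 * y $ 1) + x $ 2 * y $ 2 + x $ 3 * y $ 3 + x $ 4 * y $ 4"

definition partial_deriv :: "3 \<Rightarrow> (real^3 \<Rightarrow> 'b::real_normed_vector) \<Rightarrow> real^3 \<Rightarrow> 'b" where
  "partial_deriv j F u = frechet_derivative F (at u) (axis j 1)"

text \<open>
  A hypersurface is given by an immersion \<open>X\<close> of an open set of parameters; functions, vector
  fields and operators on it are expressed in these coordinates, tangent vectors and
  endomorphisms of tangent spaces in the frame \<open>partial_deriv i X u\<close>.
\<close>

definition metric :: "(real^3 \<Rightarrow> real^4) \<Rightarrow> real^3 \<Rightarrow> real^3^3" where
  "metric X u = (\<chi> i j. lorentz (partial_deriv i X u) (partial_deriv j X u))"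

definition oriented_hypersurface ::
    "(real^3) set \<Rightarrow> (real^3 \<Rightarrow> real^4) \<Rightarrow> (real^3 \<Rightarrow> real^4) \<Rightarrow> bool" where
  "oriented_hypersurface U X N \<longleftrightarrow>
     open U \<and> smooth_on U X \<and> smooth_on U N \<and>
     (\<forall>u\<in>U. inj (frechet_derivative X (at u)) \<and> det (metric X u) \<noteq> 0) \<and>
     (\<forall>u\<in>U. \<forall>j. lorentz (N u) (partial_deriv j X u) = 0) \<and>
     (\<exists>\<epsilon>\<in>{-1, 1}. \<forall>u\<in>U. lorentz (N u) (N u) = \<epsilon>)"

definition christoffel :: "(real^3 \<Rightarrow> real^4) \<Rightarrow> real^3 \<Rightarrow> 3 \<Rightarrow> 3 \<Rightarrow> 3 \<Rightarrow> real" where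
  "christoffel X u l i j =
     (\<Sum>m\<in>UNIV. matrix_inv (metric X u) $ l $ m *
        (partial_deriv i (\<lambda>v. metric X v $ j $ m) u
         + partial_deriv j (\<lambda>v. metric X v $ i $ m) u
         - partial_deriv m (\<lambda>v. metric X v $ i $ j) u)) / 2"

definition gradient :: "(real^3 \<Rightarrow> real^4) \<Rightarrow> (real^3 \<Rightarrow> real) \<Rightarrow> real^3 \<Rightarrow> real^3" where
  "gradient X \<phi> u = matrix_inv (metric X u) *v (\<chi> j. partial_deriv j \<phi> u)"

text \<open>The Hessian operator sends \<open>Y\<close> to the covariant derivative of the gradient along \<open>Y\<close>.\<close>

definition hessian :: "(real^3 \<Rightarrow> real^4) \<Rightarrow> (real^3 \<Rightarrow> real) \<Rightarrow> real^3 \<Rightarrow> real^3^3" where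
  "hessian X \<phi> u =
     (\<chi> i j. partial_deriv j (\<lambda>v. gradient X \<phi> v $ i) u
            + (\<Sum>k\<in>UNIV. christoffel X u i j k * gradient X \<phi> u $ k))"

text \<open>The matrix of \<open>S = -dN\<close>: column \<open>j\<close> holds the components of \<open>S\<close> applied to the \<open>j\<close>-th
  coordinate vector.\<close>

definition shape_operator ::
    "(real^3 \<Rightarrow> real^4) \<Rightarrow> (real^3 \<Rightarrow> real^4) \<Rightarrow> real^3 \<Rightarrow> real^3^3" where
  "shape_operator X N u =
     (THE S. \<forall>j. - partial_deriv j N u = (\<Sum>i\<in>UNIV. S $ i $ j *\<^sub>R partial_deriv i X u))"

text \<open>Eigenvalues of \<open>S\<close> with algebraic multiplicity.  They may be non-real, as \<open>S\<close> is
  self-adjoint only with respect to a possibly indefinite metric; their symmetric functions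
  are always real.\<close>

definition principal_curvatures :: "real^3^3 \<Rightarrow> 3 \<Rightarrow> complex" where
  "principal_curvatures S =
     (SOME \<kappa>. \<forall>z. det (mat z - map_matrix complex_of_real S) = (\<Prod>i\<in>UNIV. z - \<kappa> i))"

definition curv_coeff :: "nat \<Rightarrow> real^3^3 \<Rightarrow> real" where
  "curv_coeff k S =
     (-1) ^ k * Re (\<Sum>A | card A = k. \<Prod>i\<in>A. principal_curvatures S i)"

primrec newton_transformation :: "nat \<Rightarrow> real^3^3 \<Rightarrow> real^3^3" where
  "newton_transformation 0 S = mat 1"
| "newton_transformation (Suc k) S =
     mat (curv_coeff (Suc k) S) + S ** newton_transformation k S"

definition L_op ::
    "nat \<Rightarrow> (real^3 \<Rightarrow> real^4) \<Rightarrow> (real^3 \<Rightarrow> real^4) \<Rightarrow> (real^3 \<Rightarrow> real) \<Rightarrow> real^3 \<Rightarrow> real" where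
  "L_op k X N \<phi> u =
     trace (newton_transformation k (shape_operator X N u) ** hessian X \<phi> u)"

definition L_op_vec ::
    "nat \<Rightarrow> (real^3 \<Rightarrow> real^4) \<Rightarrow> (real^3 \<Rightarrow> real^4) \<Rightarrow> (real^3 \<Rightarrow> real^4) \<Rightarrow> real^3 \<Rightarrow> real^4" where
  "L_op_vec k X N F u = (\<chi> i. L_op k X N (\<lambda>v. F v $ i) u)"

definition generalized_1_type_Gauss_map_with ::
    "nat \<Rightarrow> (real^3) set \<Rightarrow> (real^3 \<Rightarrow> real^4) \<Rightarrow> (real^3 \<Rightarrow> real^4) \<Rightarrow>
     (real^3 \<Rightarrow> real) \<Rightarrow> (real^3 \<Rightarrow> real) \<Rightarrow> real^4 \<Rightarrow> bool" where
  "generalized_1_type_Gauss_map_with k U X N m n C \<longleftrightarrow>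
     smooth_on U m \<and> smooth_on U n \<and> (\<exists>u\<in>U. m u \<noteq> 0) \<and> (\<exists>u\<in>U. n u \<noteq> 0) \<and> C \<noteq> 0 \<and>
     (\<forall>u\<in>U. L_op_vec k X N N u = m u *\<^sub>R N u + n u *\<^sub>R C)"

definition generalized_1_type_Gauss_map ::
    "nat \<Rightarrow> (real^3) set \<Rightarrow> (real^3 \<Rightarrow> real^4) \<Rightarrow> (real^3 \<Rightarrow> real^4) \<Rightarrow> bool" where
  "generalized_1_type_Gauss_map k U X N \<longleftrightarrow>
     (\<exists>m n C. generalized_1_type_Gauss_map_with k U X N m n C)"

text \<open>The parameter vector \<open>u\<close> is \<open>(s, t, w)\<close>.  The angles range over all reals with
  \<open>cos t \<noteq> 0\<close> instead of \<open>[0, 2\<pi>]\<close>, which keeps the domain open; everything is \<open>2\<pi>\<close>-periodic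
  in \<open>t\<close> and \<open>w\<close>, so the hypersurface is the same.\<close>

definition rot_domain :: "real set \<Rightarrow> (real^3) set" where
  "rot_domain I = {u. u $ 1 \<in> I \<and> cos (u $ 2) \<noteq> 0}"

definition rot_hypersurface :: "(real \<Rightarrow> real) \<Rightarrow> real^3 \<Rightarrow> real^4" where
  "rot_hypersurface f u =
     (let s = u $ 1; t = u $ 2; w = u $ 3
      in vector [f s, - s * cos t * sin w, - s * sin t, s * cos t * cos w])"

definition rot_gauss_map :: "(real \<Rightarrow> real) \<Rightarrow> real^3 \<Rightarrow> real^4" where
  "rot_gauss_map f u =
     (let s = u $ 1; t = u $ 2; w = u $ 3; f' = deriv f s
      in (1 / sqrt (f'\<^sup>2 - 1)) *\<^sub>R
           vector [1, - f' * cos t * sin w, - f' * sin t, f' * cos t * cos w])"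

end

theory Submission
  imports Defs
begin

text \<open>
  Write \<open>W = sqrt (f'\<^sup>2 - 1)\<close>. The metric is diagonal with entries \<open>-W\<^sup>2\<close>, \<open>s\<^sup>2\<close>, \<open>s\<^sup>2 cos\<^sup>2 t\<close>,
  and \<open>S\<close> is diagonal with entries \<open>\<kappa>\<^sub>1 = f'' / W\<^sup>3\<close> and \<open>\<kappa>\<^sub>2 = \<kappa>\<^sub>3 = -f' / (s W)\<close>, so that \<open>P\<^sub>2\<close> is
  diagonal with entries \<open>\<kappa>\<^sub>2\<kappa>\<^sub>3\<close>, \<open>\<kappa>\<^sub>1\<kappa>\<^sub>3\<close>, \<open>\<kappa>\<^sub>1\<kappa>\<^sub>2\<close>. Every component of \<open>N\<close> is a product
  \<open>A(s) B(t) C(w)\<close> whose angular factor \<open>B(t) C(w)\<close> is an eigenfunction of the Laplacian of the unit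
  sphere, with eigenvalue \<open>0\<close> for the first component and \<open>-2\<close> for the others. Hence \<open>L\<^sub>2\<close> only acts
  on the radial factor, and the claim reduces to two rational identities in \<open>s\<close>, \<open>W\<close> and the
  derivatives of \<open>f\<close>, modulo \<open>f'\<^sup>2 = W\<^sup>2 + 1\<close>.
\<close>

subsection \<open>Smooth functions\<close>

lemma frechet_derivative_vec_nth:
  fixes F :: "'a::real_normed_vector \<Rightarrow> real^'n"
  assumes "F differentiable (at x)"
  shows "frechet_derivative (\<lambda>x. F x $ i) (at x) v = frechet_derivative F (at x) v $ i"
proof -
  have "((\<lambda>x. F x $ i) has_derivative (\<lambda>v. frechet_derivative F (at x) v $ i)) (at x)"
    using assms bounded_linear.has_derivative[OF bounded_linear_vec_nth]
    by (simp add: frechet_derivative_works)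
  then show ?thesis by (simp add: frechet_derivative_at[symmetric])
qed

lemma differentiable_vec_nth_iff:
  fixes F :: "'a::real_normed_vector \<Rightarrow> real^'n"
  shows "F differentiable (at x) \<longleftrightarrow> (\<forall>i. (\<lambda>x. F x $ i) differentiable (at x))"
proof
  assume "F differentiable (at x)"
  then show "\<forall>i. (\<lambda>x. F x $ i) differentiable (at x)"
    using bounded_linear.has_derivative[OF bounded_linear_vec_nth]
    by (fastforce simp: differentiable_def)
next
  assume "\<forall>i. (\<lambda>x. F x $ i) differentiable (at x)"
  then obtain D where D: "\<And>i. ((\<lambda>x. F x $ i) has_derivative D i) (at x)"
    unfolding differentiable_def by metis
  have "(F has_derivative (\<lambda>h. \<chi> i. D i h)) (at x)"
    by (subst has_derivative_componentwise_within)
      (auto simp: Basis_vec_def inner_axis D)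
  then show "F differentiable (at x)" by (rule differentiableI)
qed

text \<open>Only values on the open set matter: equality there is equality near each of its points
  and forces equal derivatives. The induction generalises both functions, since one step replaces
  them by their directional derivatives.\<close>

lemma Ck_on_cong:
  assumes "open U" "\<And>x. x \<in> U \<Longrightarrow> f x = g x" "Ck_on k U f"
  shows "Ck_on k U g"
  using assms(2,3)
proof (induction k arbitrary: f g)
  case 0
  have "continuous_on U g"
    by (rule continuous_on_eq[of U f]) (use 0 in simp_all)
  then show ?case by simp
next
  case (Suc k)
  have d: "(g has_derivative frechet_derivative f (at x)) (at x)" if "x \<in> U" for x
  proof (rule has_derivative_transform_within_open)
    show "(f has_derivative frechet_derivative f (at x)) (at x)"
      using Suc.prems(2) that by (simp add: frechet_derivative_works)
  qed (use that \<open>open U\<close> Suc.prems(1) in blast)+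
  have "Ck_on k U (\<lambda>x. frechet_derivative g (at x) v)" for v
  proof (rule Suc.IH)
    show "frechet_derivative f (at x) v = frechet_derivative g (at x) v" if "x \<in> U" for x
      by (rule fun_cong[OF frechet_derivative_at[OF d[OF that]]])
  qed (use Suc.prems(2) in simp)
  with d show ?case by (auto intro: differentiableI)
qed

text \<open>The recursion is stated with \<open>frechet_derivative\<close>. This rule lets any
  explicit derivative \<open>D\<close>, valid on \<open>U\<close>, take its place, so that the
  closure proofs can use the ordinary differentiation rules.\<close>

lemma Ck_on_SucI:
  assumes "open U" "\<And>x. x \<in> U \<Longrightarrow> (f has_derivative D x) (at x)"
    and "\<And>v. Ck_on k U (\<lambda>x. D x v)"
  shows "Ck_on (Suc k) U f"
proof -
  have "Ck_on k U (\<lambda>x. frechet_derivative f (at x) v)" for v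
    using assms(1) _ assms(3)[of v]
    by (rule Ck_on_cong) (simp add: frechet_derivative_at[OF assms(2), symmetric])
  then show ?thesis using assms(2) by (auto intro: differentiableI)
qed

lemma Ck_on_SucD:
  assumes "open U" "Ck_on (Suc k) U f"
  shows "Ck_on k U f"
  using assms(2)
proof (induction k arbitrary: f)
  case 0
  then show ?case
    using differentiable_imp_continuous_within
    by (auto intro!: continuous_at_imp_continuous_on)
qed (use \<open>open U\<close> in auto)

lemma Ck_on_has_derivative:
  assumes "Ck_on (Suc k) U f" "x \<in> U"
  shows "(f has_derivative frechet_derivative f (at x)) (at x)"
  using assms by (simp add: frechet_derivative_works)

lemma Ck_on_const: "open U \<Longrightarrow> Ck_on k U (\<lambda>x. c)"
proof (induction k arbitrary: c)
  case (Suc k)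
  show ?case by (rule Ck_on_SucI[where D = "\<lambda>x v. 0"]) (use Suc in auto)
qed simp

lemma Ck_on_bounded_linear:
  assumes "open U" "bounded_linear f"
  shows "Ck_on k U f"
proof (cases k)
  case 0
  then show ?thesis using assms by (simp add: linear_continuous_on)
next
  case (Suc l)
  have "Ck_on (Suc l) U f"
    by (rule Ck_on_SucI[where D = "\<lambda>x. f"])
      (use assms in \<open>auto intro: Ck_on_const bounded_linear_imp_has_derivative\<close>)
  then show ?thesis using Suc by simp
qed

lemma Ck_on_add:
  assumes "open U" "Ck_on k U f" "Ck_on k U g"
  shows "Ck_on k U (\<lambda>x. f x + g x)"
  using assms(2,3)
proof (induction k arbitrary: f g)
  case 0
  then show ?case by (auto intro!: continuous_on_add continuous_on_mult)
next
  case (Suc k)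
  show ?case
  proof (rule Ck_on_SucI[OF \<open>open U\<close> has_derivative_add[OF
          Ck_on_has_derivative[OF Suc.prems(1)] Ck_on_has_derivative[OF Suc.prems(2)]]])
    show "Ck_on k U (\<lambda>x. frechet_derivative f (at x) v + frechet_derivative g (at x) v)" for v
      by (rule Suc.IH) (use Suc.prems in simp_all)
  qed
qed

text \<open>By the Leibniz rule the derivative is a sum of products of lower order. The
  undifferentiated factors come with order \<open>Suc k\<close> and are first lowered by
  \<open>Ck_on_SucD\<close>.\<close>

lemma Ck_on_mult:
  fixes f g :: "'a::real_normed_vector \<Rightarrow> real"
  assumes "open U" "Ck_on k U f" "Ck_on k U g"
  shows "Ck_on k U (\<lambda>x. f x * g x)"
  using assms(2,3)
proof (induction k arbitrary: f g)
  case 0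
  then show ?case by (auto intro!: continuous_on_add continuous_on_mult)
next
  case (Suc k)
  have d: "((\<lambda>x. f x * g x) has_derivative
      (\<lambda>v. f x * frechet_derivative g (at x) v + frechet_derivative f (at x) v * g x)) (at x)"
    if "x \<in> U" for x
    using Suc.prems that by (intro has_derivative_mult Ck_on_has_derivative)
  have "Ck_on k U f" "Ck_on k U g" using Suc.prems Ck_on_SucD \<open>open U\<close> by blast+
  then have "Ck_on k U (\<lambda>x. f x * frechet_derivative g (at x) v + frechet_derivative f (at x) v * g x)"
    for v
    using Suc.prems by (intro Ck_on_add \<open>open U\<close> Suc.IH) simp_all
  with d show ?case by (rule Ck_on_SucI[OF \<open>open U\<close>])
qed

lemma Ck_on_vec_nthI:
  fixes F :: "'a::real_normed_vector \<Rightarrow> real^'n"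
  assumes "\<And>i. Ck_on k U (\<lambda>x. F x $ i)" "open U"
  shows "Ck_on k U F"
  using assms(1)
proof (induction k arbitrary: F)
  case 0
  then have "continuous_on U (\<lambda>x. \<chi> i. F x $ i)"
    by (intro continuous_on_vec_lambda) simp
  then show ?case by simp
next
  case (Suc k)
  then have d: "F differentiable (at x)" if "x \<in> U" for x
    using that by (simp add: differentiable_vec_nth_iff)
  have "Ck_on k U (\<lambda>x. frechet_derivative F (at x) v)" for v
  proof (rule Suc.IH)
    fix i
    have "Ck_on k U (\<lambda>x. frechet_derivative (\<lambda>x. F x $ i) (at x) v)"
      using Suc.prems[of i] by simp
    then show "Ck_on k U (\<lambda>x. frechet_derivative F (at x) v $ i)"
      by (rule Ck_on_cong[OF \<open>open U\<close>, rotated]) (rule frechet_derivative_vec_nth[OF d])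
  qed
  with d show ?case by simp
qed

lemma Ck_on_real_derivI:
  assumes "open V" "\<And>y. y \<in> V \<Longrightarrow> (h has_real_derivative h' y) (at y)" "Ck_on k V h'"
  shows "Ck_on (Suc k) V h"
proof (rule Ck_on_SucI[where D = "\<lambda>y v. h' y * v"])
  show "Ck_on k V (\<lambda>y. h' y * v)" for v
    by (intro Ck_on_mult Ck_on_const assms)
qed (use assms in \<open>simp_all add: has_field_derivative_def\<close>)

lemma Ck_on_frechet_real:
  fixes h :: "real \<Rightarrow> real"
  assumes "Ck_on (Suc k) V h" "y \<in> V"
  shows "(h has_real_derivative frechet_derivative h (at y) 1) (at y)"
proof -
  have d: "(h has_derivative frechet_derivative h (at y)) (at y)"
    by (rule Ck_on_has_derivative[OF assms])
  \<comment> \<open>A linear map on the reals is multiplication by its value at 1.\<close>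
  have "frechet_derivative h (at y) = (\<lambda>v. frechet_derivative h (at y) 1 * v)"
  proof
    show "frechet_derivative h (at y) v = frechet_derivative h (at y) 1 * v" for v
      using linear_cmul[OF has_derivative_linear[OF d], of v 1] by (simp add: mult.commute)
  qed
  with d show ?thesis unfolding has_field_derivative_def by metis
qed

text \<open>With a scalar outer function the chain rule yields a plain product: the derivative of
  \<open>h\<close> at \<open>g x\<close>, covered by the induction hypothesis for varying
  \<open>h\<close>, times a directional derivative of \<open>g\<close>.\<close>

lemma Ck_on_compose:
  fixes g :: "'a::real_normed_vector \<Rightarrow> real" and h :: "real \<Rightarrow> real"
  assumes "open U" "Ck_on k V h" "Ck_on k U g" "\<And>x. x \<in> U \<Longrightarrow> g x \<in> V"
  shows "Ck_on k U (\<lambda>x. h (g x))"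
  using assms(2,3)
proof (induction k arbitrary: h)
  case 0
  then show ?case using assms(4) continuous_on_compose2[of V h U g] by auto
next
  case (Suc k)
  have g: "Ck_on k U g" using Suc.prems Ck_on_SucD \<open>open U\<close> by blast
  have d: "((\<lambda>x. h (g x)) has_derivative
      (\<lambda>v. frechet_derivative h (at (g x)) 1 * frechet_derivative g (at x) v)) (at x)"
    if "x \<in> U" for x
    using diff_chain_at[OF Ck_on_has_derivative[OF Suc.prems(2) that],
        OF Ck_on_frechet_real[OF Suc.prems(1) assms(4)[OF that], unfolded has_field_derivative_def]]
    by (simp add: o_def)
  have "Ck_on k U (\<lambda>x. frechet_derivative h (at (g x)) 1 * frechet_derivative g (at x) v)" for v
    by (rule Ck_on_mult[OF \<open>open U\<close> Suc.IH]) (use Suc.prems g in simp_all)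
  with d show ?case by (rule Ck_on_SucI[OF \<open>open U\<close>])
qed

text \<open>Each function is the derivative of the other up to sign, so both orders rise together.
  The sign is written as a factor \<open>(-1)\<close> to fit \<open>Ck_on_mult\<close>.\<close>

lemma Ck_on_sin_cos: "Ck_on k UNIV (sin :: real \<Rightarrow> real) \<and> Ck_on k UNIV (cos :: real \<Rightarrow> real)"
proof (induction k)
  case 0
  show ?case by (simp add: continuous_on_sin continuous_on_cos)
next
  case (Suc k)
  have "Ck_on k UNIV (\<lambda>x. (-1) * sin x :: real)"
    by (intro Ck_on_mult Ck_on_const) (use Suc in simp_all)
  then have "Ck_on (Suc k) UNIV (cos :: real \<Rightarrow> real)"
    by (intro Ck_on_real_derivI[of _ cos "\<lambda>x. (-1) * sin x"]) (auto intro!: derivative_eq_intros)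
  moreover have "Ck_on (Suc k) UNIV (sin :: real \<Rightarrow> real)"
    by (rule Ck_on_real_derivI[of _ sin cos]) (use Suc in \<open>auto intro: DERIV_sin\<close>)
  ultimately show ?case by blast
qed

text \<open>The derivative is minus the square of the function itself, so the induction hypothesis
  and the product rule close the step.\<close>

lemma Ck_on_inverse: "Ck_on k (- {0}) (inverse :: real \<Rightarrow> real)"
proof (induction k)
  case 0
  show ?case by (auto intro!: continuous_intros)
next
  case (Suc k)
  show ?case
  proof (rule Ck_on_real_derivI)
    show "Ck_on k (- {0}) (\<lambda>x::real. (-1) * (inverse x * inverse x))"
      by (intro Ck_on_mult Ck_on_const Suc) auto
  qed (auto intro!: derivative_eq_intros)
qed

text \<open>The derivative is half of \<open>inverse\<close> composed with \<open>sqrt\<close>; the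
  induction hypothesis and \<open>Ck_on_compose\<close> cover it on the positive half-line.\<close>

lemma Ck_on_sqrt: "Ck_on k {0<..} sqrt"
proof (induction k)
  case 0
  show ?case by (auto intro!: continuous_intros)
next
  case (Suc k)
  show ?case
  proof (rule Ck_on_real_derivI)
    show "Ck_on k {0<..} (\<lambda>x. inverse (sqrt x) * (1/2))"
      by (intro Ck_on_mult Ck_on_const Ck_on_compose[OF _ Ck_on_inverse] Suc) auto
  qed (auto intro!: derivative_eq_intros simp: field_simps)
qed

section \<open>Closure properties of smooth functions\<close>

lemma smooth_on_cong:
  "open U \<Longrightarrow> smooth_on U f \<Longrightarrow> (\<And>x. x \<in> U \<Longrightarrow> f x = g x) \<Longrightarrow> smooth_on U g"
  unfolding smooth_on_def using Ck_on_cong by blast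

lemma smooth_on_const: "open U \<Longrightarrow> smooth_on U (\<lambda>x. c)"
  by (simp add: smooth_on_def Ck_on_const)

lemma smooth_on_bounded_linear: "open U \<Longrightarrow> bounded_linear f \<Longrightarrow> smooth_on U f"
  by (simp add: smooth_on_def Ck_on_bounded_linear)

lemma smooth_on_add:
  "open U \<Longrightarrow> smooth_on U f \<Longrightarrow> smooth_on U g \<Longrightarrow> smooth_on U (\<lambda>x. f x + g x)"
  by (simp add: smooth_on_def Ck_on_add)

lemma smooth_on_mult:
  fixes f g :: "'a::real_normed_vector \<Rightarrow> real"
  shows "open U \<Longrightarrow> smooth_on U f \<Longrightarrow> smooth_on U g \<Longrightarrow> smooth_on U (\<lambda>x. f x * g x)"
  by (simp add: smooth_on_def Ck_on_mult)

lemma smooth_on_minus: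
  fixes f :: "'a::real_normed_vector \<Rightarrow> real"
  assumes "open U" "smooth_on U f"
  shows "smooth_on U (\<lambda>x. - f x)"
  using smooth_on_mult[OF assms(1) smooth_on_const[OF assms(1)] assms(2), of "-1"] by simp

lemma smooth_on_diff:
  fixes f g :: "'a::real_normed_vector \<Rightarrow> real"
  assumes "open U" "smooth_on U f" "smooth_on U g"
  shows "smooth_on U (\<lambda>x. f x - g x)"
  using smooth_on_add[OF assms(1,2) smooth_on_minus[OF assms(1,3)]] by simp

lemma smooth_on_power:
  fixes f :: "'a::real_normed_vector \<Rightarrow> real"
  assumes "open U" "smooth_on U f"
  shows "smooth_on U (\<lambda>x. f x ^ k)"
  by (induction k) (simp_all add: assms smooth_on_mult smooth_on_const)

lemma smooth_on_compose:
  fixes g :: "'a::real_normed_vector \<Rightarrow> real" and h :: "real \<Rightarrow> real"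
  assumes "open U" "smooth_on V h" "smooth_on U g" "\<And>x. x \<in> U \<Longrightarrow> g x \<in> V"
  shows "smooth_on U (\<lambda>x. h (g x))"
  using assms Ck_on_compose unfolding smooth_on_def by blast

lemma smooth_on_sin:
  fixes g :: "'a::real_normed_vector \<Rightarrow> real"
  shows "open U \<Longrightarrow> smooth_on U g \<Longrightarrow> smooth_on U (\<lambda>x. sin (g x))"
  by (rule smooth_on_compose[where V = UNIV]) (auto simp: smooth_on_def Ck_on_sin_cos)

lemma smooth_on_cos:
  fixes g :: "'a::real_normed_vector \<Rightarrow> real"
  shows "open U \<Longrightarrow> smooth_on U g \<Longrightarrow> smooth_on U (\<lambda>x. cos (g x))"
  by (rule smooth_on_compose[where V = UNIV]) (auto simp: smooth_on_def Ck_on_sin_cos)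

lemma smooth_on_divide:
  fixes f g :: "'a::real_normed_vector \<Rightarrow> real"
  assumes "open U" "smooth_on U f" "smooth_on U g" "\<And>x. x \<in> U \<Longrightarrow> g x \<noteq> 0"
  shows "smooth_on U (\<lambda>x. f x / g x)"
proof -
  have "smooth_on U (\<lambda>x. inverse (g x))"
    by (rule smooth_on_compose[where V = "- {0}"]) (use assms in \<open>auto simp: smooth_on_def Ck_on_inverse\<close>)
  then show ?thesis
    unfolding divide_inverse by (rule smooth_on_mult[OF assms(1,2)])
qed

lemma smooth_on_sqrt:
  fixes g :: "'a::real_normed_vector \<Rightarrow> real"
  assumes "open U" "smooth_on U g" "\<And>x. x \<in> U \<Longrightarrow> g x > 0"
  shows "smooth_on U (\<lambda>x. sqrt (g x))"
  by (rule smooth_on_compose[where V = "{0<..}"]) (use assms in \<open>auto simp: smooth_on_def Ck_on_sqrt\<close>)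

lemma smooth_on_vec_nthI:
  fixes F :: "'a::real_normed_vector \<Rightarrow> real^'n"
  shows "open U \<Longrightarrow> (\<And>i. smooth_on U (\<lambda>x. F x $ i)) \<Longrightarrow> smooth_on U F"
  by (simp add: smooth_on_def Ck_on_vec_nthI)

lemma smooth_on_differentiable: "smooth_on U f \<Longrightarrow> x \<in> U \<Longrightarrow> f differentiable (at x)"
  unfolding smooth_on_def by (metis Ck_on.simps(2))

lemma smooth_on_deriv:
  fixes f :: "real \<Rightarrow> real"
  assumes "open I" "smooth_on I f"
  shows "smooth_on I (deriv f)"
proof -
  have "smooth_on I (\<lambda>x. frechet_derivative f (at x) 1)"
    using assms(2) unfolding smooth_on_def by (metis Ck_on.simps(2))
  moreover have "frechet_derivative f (at x) 1 = deriv f x" if "x \<in> I" for x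
  proof -
    have "Ck_on (Suc 0) I f" using assms(2) unfolding smooth_on_def ..
    from Ck_on_frechet_real[OF this that] show ?thesis by (rule DERIV_imp_deriv[symmetric])
  qed
  ultimately show ?thesis by (rule smooth_on_cong[OF assms(1)])
qed

lemma smooth_on_has_deriv:
  fixes f :: "real \<Rightarrow> real"
  assumes "smooth_on I f" "x \<in> I"
  shows "(f has_real_derivative deriv f x) (at x)"
  using smooth_on_differentiable[OF assms] DERIV_deriv_iff_real_differentiable by blast

subsection \<open>Diagonal matrices\<close>

definition diag_matrix :: "'a::zero^'n \<Rightarrow> 'a^'n^'n" where
  "diag_matrix d = (\<chi> i j. if i = j then d $ i else 0)"

lemma diag_matrix_nth [simp]: "diag_matrix d $ i $ j = (if i = j then d $ i else 0)"
  by (simp add: diag_matrix_def)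

lemma diag_matrix_mult:
  fixes a b :: "'a::semiring_1^'n"
  shows "diag_matrix a ** diag_matrix b = diag_matrix (\<chi> i. a $ i * b $ i)"
proof -
  have "(\<Sum>k\<in>UNIV. diag_matrix a $ i $ k * diag_matrix b $ k $ j)
      = (\<Sum>k\<in>UNIV. if i = k then (if i = j then a $ i * b $ i else 0) else 0)" for i j
    by (rule sum.cong) auto
  then show ?thesis by (simp add: matrix_matrix_mult_def vec_eq_iff)
qed

lemma det_diag_matrix:
  fixes d :: "'a::comm_ring_1^'n"
  shows "det (diag_matrix d) = (\<Prod>i\<in>UNIV. d $ i)"
  by (subst det_diagonal) simp_all

text \<open>\<open>matrix_inv\<close> is defined by choice, so its value is pinned down through
  uniqueness of two-sided inverses.\<close>

lemma matrix_inv_unique: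
  fixes A B :: "'a::semiring_1^'n^'n"
  assumes "A ** B = mat 1" "B ** A = mat 1"
  shows "matrix_inv A = B"
proof -
  have "A ** matrix_inv A = mat 1 \<and> matrix_inv A ** A = mat 1"
    unfolding matrix_inv_def by (rule someI[of _ B]) (use assms in simp)
  then show ?thesis
    using assms by (metis matrix_mul_assoc matrix_mul_lid matrix_mul_rid)
qed

lemma matrix_inv_diag_matrix:
  fixes d :: "real^'n"
  assumes "\<And>i. d $ i \<noteq> 0"
  shows "matrix_inv (diag_matrix d) = diag_matrix (\<chi> i. 1 / d $ i)"
  by (rule matrix_inv_unique) (use assms in \<open>simp_all add: diag_matrix_mult vec_eq_iff mat_def\<close>)

lemma trace_diag_matrix_mult:
  fixes d :: "real^'n"
  shows "trace (diag_matrix d ** H) = (\<Sum>i\<in>UNIV. d $ i * H $ i $ i)"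
proof -
  have "(\<Sum>k\<in>UNIV. diag_matrix d $ i $ k * H $ k $ i)
      = (\<Sum>k\<in>UNIV. if i = k then d $ i * H $ i $ i else 0)" for i
    by (rule sum.cong) auto
  then show ?thesis by (simp add: trace_def matrix_matrix_mult_def)
qed

text \<open>The choice fixes the curvatures at best up to order, so only symmetric information can
  be extracted. The diagonal entries witness that a factorisation exists, and hence the chosen one
  has the same product.\<close>

lemma principal_curvatures_char_poly:
  fixes d :: "real^3"
  shows "(\<Prod>i\<in>UNIV. z - principal_curvatures (diag_matrix d) i) = (\<Prod>i\<in>UNIV. z - complex_of_real (d $ i))"
proof -
  let ?P = "\<lambda>\<kappa>. \<forall>z. det (mat z - map_matrix complex_of_real (diag_matrix d)) = (\<Prod>i\<in>UNIV. z - \<kappa> i)"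
  have det: "det (mat z - map_matrix complex_of_real (diag_matrix d)) = (\<Prod>i\<in>UNIV. z - complex_of_real (d $ i))" for z
    by (subst det_diagonal) (simp_all add: mat_def map_matrix_def)
  have "?P (principal_curvatures (diag_matrix d))"
    unfolding principal_curvatures_def by (rule someI[of ?P "\<lambda>i. complex_of_real (d $ i)"]) (use det in blast)
  with det show ?thesis by metis
qed

lemma card_1_subsets_3: "{A::3 set. card A = 1} = {{1}, {2}, {3}}"
  using exhaust_3 by (auto simp: card_1_singleton_iff)

lemma card_2_subsets_3: "{A::3 set. card A = 2} = {{1, 2}, {1, 3}, {2, 3}}"
proof -
  have "A \<in> {{1, 2}, {1, 3}, {2, 3}}" if c: "card A = 2" for A :: "3 set"
  proof -
    obtain x y where "A = {x, y}" "x \<noteq> y" using c unfolding card_2_iff by metis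
    then show ?thesis using exhaust_3[of x] exhaust_3[of y] by auto
  qed
  then show ?thesis by auto
qed

lemma prod_3: "prod f (UNIV::3 set) = f 1 * f 2 * f 3"
  unfolding UNIV_3 by (simp add: ac_simps)

lemma curv_coeff_diag_matrix:
  fixes d :: "real^3"
  shows "curv_coeff 1 (diag_matrix d) = - (d $ 1 + d $ 2 + d $ 3)"
    and "curv_coeff 2 (diag_matrix d) = d $ 1 * d $ 2 + d $ 1 * d $ 3 + d $ 2 * d $ 3"
proof -
  define k where "k = principal_curvatures (diag_matrix d)"
  define e where "e i = complex_of_real (d $ i)" for i
  have P: "(z - k 1) * (z - k 2) * (z - k 3) = (z - e 1) * (z - e 2) * (z - e 3)" for z
    using principal_curvatures_char_poly[of z d] unfolding prod_3 k_def e_def .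
  \<comment> \<open>The symmetric functions are read off from three values of the cubic with roots
    \<open>x\<close>, \<open>y\<close>, \<open>w\<close>, namely at 0, 1 and -1. As \<open>P\<close>
    identifies the two cubics everywhere, it identifies these combinations of values.\<close>
  have s1: "x + y + w = (0 - x) * (0 - y) * (0 - w)
      - ((1 - x) * (1 - y) * (1 - w) + (- 1 - x) * (- 1 - y) * (- 1 - w)) / 2" for x y w :: complex
    by (simp add: field_simps)
  have s2: "x * y + x * w + y * w =
      ((1 - x) * (1 - y) * (1 - w) - (- 1 - x) * (- 1 - y) * (- 1 - w)) / 2 - 1" for x y w :: complex
    by (simp add: field_simps)
  have 1: "k 1 + k 2 + k 3 = e 1 + e 2 + e 3"
    unfolding s1 P ..
  have 2: "k 1 * k 2 + k 1 * k 3 + k 2 * k 3 = e 1 * e 2 + e 1 * e 3 + e 2 * e 3"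
    unfolding s2 P ..
  show "curv_coeff 1 (diag_matrix d) = - (d $ 1 + d $ 2 + d $ 3)"
    using arg_cong[OF 1, of Re]
    by (simp add: curv_coeff_def card_1_subsets_3[simplified] k_def[symmetric] e_def)
  have "(\<Sum>A | card A = 2. \<Prod>i\<in>A. k i) = k 1 * k 2 + k 1 * k 3 + k 2 * k 3"
    unfolding card_2_subsets_3 by (simp add: doubleton_eq_iff)
  then show "curv_coeff 2 (diag_matrix d) = d $ 1 * d $ 2 + d $ 1 * d $ 3 + d $ 2 * d $ 3"
    using arg_cong[OF 2, of Re] by (simp add: curv_coeff_def k_def[symmetric] e_def)
qed

text \<open>With a1, a2 the two curvature coefficients above, the diagonal entry at \<open>i\<close>
  is a2 + d_i (a1 + d_i), and expanding leaves the product of the other two eigenvalues.\<close>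

lemma newton_transformation_2_diag_matrix:
  fixes d :: "real^3"
  shows "newton_transformation 2 (diag_matrix d) = diag_matrix (vector [d $ 2 * d $ 3, d $ 1 * d $ 3, d $ 1 * d $ 2])"
proof -
  have mat: "mat c = diag_matrix (\<chi> i::3. c)" for c :: real
    by (simp add: vec_eq_iff mat_def)
  have plus: "diag_matrix a + diag_matrix b = diag_matrix (\<chi> i. a $ i + b $ i)" for a b :: "real^3"
    by (simp add: vec_eq_iff)
  have "newton_transformation 2 (diag_matrix d) = diag_matrix (\<chi> i. curv_coeff 2 (diag_matrix d)
      + d $ i * (curv_coeff 1 (diag_matrix d) + d $ i))"
    by (simp add: numeral_2_eq_2 diag_matrix_mult mat plus)
  also have "\<dots> = diag_matrix (vector [d $ 2 * d $ 3, d $ 1 * d $ 3, d $ 1 * d $ 2])"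
    unfolding curv_coeff_diag_matrix
    by (rule arg_cong[of _ _ diag_matrix]) (simp add: vec_eq_iff forall_3 algebra_simps)
  finally show ?thesis .
qed

subsection \<open>Partial derivatives and diagonal metrics\<close>

lemma partial_deriv_eqI: "(F has_derivative D) (at u) \<Longrightarrow> partial_deriv j F u = D (axis j 1)"
  unfolding partial_deriv_def using frechet_derivative_at[of F D u] by simp

lemma partial_deriv_cong:
  assumes "open U" "u \<in> U" "\<And>v. v \<in> U \<Longrightarrow> F v = G v"
  shows "partial_deriv j F u = partial_deriv j G u"
proof -
  \<comment> \<open>No differentiability is assumed: both functions have the same derivatives at
    \<open>u\<close>, so \<open>frechet_derivative\<close> makes the same choice for both.\<close>
  have "(F has_derivative D) (at u) \<longleftrightarrow> (G has_derivative D) (at u)" for D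
    using has_derivative_transform_within_open[of F D u UNIV U G]
      has_derivative_transform_within_open[of G D u UNIV U F] assms by metis
  then show ?thesis unfolding partial_deriv_def frechet_derivative_def by presburger
qed

lemma partial_deriv_vec_nth:
  fixes F :: "real^3 \<Rightarrow> real^'n"
  shows "F differentiable (at u) \<Longrightarrow> partial_deriv j F u $ i = partial_deriv j (\<lambda>v. F v $ i) u"
  unfolding partial_deriv_def by (simp add: frechet_derivative_vec_nth)

text \<open>The components of the immersion and of the Gauss map, the metric coefficients and the
  gradient components are all products of one-variable functions on the domain. This rule turns each
  of their partial derivatives into an ordinary derivative of one factor.\<close>

lemma partial_deriv_separable:
  fixes u :: "real^3" and a b c :: "real \<Rightarrow> real"
  assumes "open U" "u \<in> U" "\<And>v. v \<in> U \<Longrightarrow> F v = a (v $ 1) * b (v $ 2) * c (v $ 3)"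
    and "(a has_real_derivative a') (at (u $ 1))" "(b has_real_derivative b') (at (u $ 2))"
      "(c has_real_derivative c') (at (u $ 3))"
  shows "partial_deriv 1 F u = a' * b (u $ 2) * c (u $ 3)"
    and "partial_deriv 2 F u = a (u $ 1) * b' * c (u $ 3)"
    and "partial_deriv 3 F u = a (u $ 1) * b (u $ 2) * c'"
proof -
  have nth: "((\<lambda>v. v $ i) has_derivative (\<lambda>h. h $ i)) (at u)" for i :: 3
    by (rule bounded_linear_imp_has_derivative[OF bounded_linear_vec_nth])
  have d: "((\<lambda>v. g (v $ i)) has_derivative (\<lambda>h. g' * h $ i)) (at u)"
    if "(g has_real_derivative g') (at (u $ i))" for g g' and i :: 3
    using diff_chain_at[OF nth that[unfolded has_field_derivative_def]] by (simp add: o_def)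
  have "partial_deriv j F u = partial_deriv j (\<lambda>v. a (v $ 1) * b (v $ 2) * c (v $ 3)) u" for j
    by (rule partial_deriv_cong[OF assms(1-3)])
  then have *: "partial_deriv j F u = (\<lambda>h. a (u $ 1) * b (u $ 2) * (c' * h $ 3) +
      (a (u $ 1) * (b' * h $ 2) + a' * h $ 1 * b (u $ 2)) * c (u $ 3)) (axis j 1)" for j
    using partial_deriv_eqI[OF has_derivative_mult[OF has_derivative_mult[OF
          d[OF assms(4)] d[OF assms(5)]] d[OF assms(6)]]] by simp
  show "partial_deriv 1 F u = a' * b (u $ 2) * c (u $ 3)"
    "partial_deriv 2 F u = a (u $ 1) * b' * c (u $ 3)"
    "partial_deriv 3 F u = a (u $ 1) * b (u $ 2) * c'"
    unfolding * by (simp_all add: axis_def)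
qed

lemma lorentz_linear:
  "lorentz (x + y) z = lorentz x z + lorentz y z"
  "lorentz (r *\<^sub>R x) z = r * lorentz x z"
  by (simp_all add: lorentz_def algebra_simps)

lemma lorentz_commute: "lorentz x y = lorentz y x"
  by (simp add: lorentz_def mult.commute)

lemma lorentz_diagonal_frame:
  assumes "metric X u = diag_matrix g"
  shows "lorentz (\<Sum>i\<in>UNIV. a i *\<^sub>R partial_deriv i X u) (partial_deriv k X u) = a k * g $ k"
proof -
  have "lorentz (partial_deriv i X u) (partial_deriv k X u) = (if i = k then g $ k else 0)" for i
    using arg_cong[OF assms, of "\<lambda>M. M $ i $ k"] by (auto simp: metric_def)
  then show ?thesis
    using exhaust_3[of k] by (auto simp: sum_3 lorentz_linear)
qed

text \<open>The coordinate frame is independent because it is orthogonal without null vectors: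
  pairing with a frame vector isolates one coefficient. Signs of the entries of \<open>g\<close> do
  not matter, so the argument survives an indefinite metric.\<close>

lemma diagonal_frame_cancel:
  assumes "metric X u = diag_matrix g" "\<And>i. g $ i \<noteq> 0"
    and "(\<Sum>i\<in>UNIV. a i *\<^sub>R partial_deriv i X u) = (\<Sum>i\<in>UNIV. b i *\<^sub>R partial_deriv i X u)"
  shows "a k = b k"
proof -
  have "a k * g $ k = b k * g $ k"
    unfolding lorentz_diagonal_frame[OF assms(1), symmetric] assms(3) ..
  then show ?thesis using assms(2) by simp
qed

text \<open>The definite description in \<open>shape_operator\<close> needs uniqueness of the
  coefficient matrix, which is independence of the frame.\<close>

lemma shape_operator_diagonal:
  assumes "metric X u = diag_matrix g" "\<And>i. g $ i \<noteq> 0"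
    and "\<And>j. - partial_deriv j N u = d $ j *\<^sub>R partial_deriv j X u"
  shows "shape_operator X N u = diag_matrix d"
  unfolding shape_operator_def
proof (rule the_equality)
  have *: "- partial_deriv j N u = (\<Sum>i\<in>UNIV. diag_matrix d $ i $ j *\<^sub>R partial_deriv i X u)" for j
    using exhaust_3[of j] by (auto simp: assms(3) sum_3)
  then show "\<forall>j. - partial_deriv j N u = (\<Sum>i\<in>UNIV. diag_matrix d $ i $ j *\<^sub>R partial_deriv i X u)"
    by blast
  fix S :: "real^3^3"
  assume S: "\<forall>j. - partial_deriv j N u = (\<Sum>i\<in>UNIV. S $ i $ j *\<^sub>R partial_deriv i X u)"
  have "S $ i $ j = diag_matrix d $ i $ j" for i j
    by (rule diagonal_frame_cancel[OF assms(1,2), where a = "\<lambda>i. S $ i $ j"])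
      (use S * in metis)+
  then show "S = diag_matrix d" by (simp add: vec_eq_iff)
qed

lemma inj_frechet_derivative_diagonal:
  assumes "metric X u = diag_matrix g" "\<And>i. g $ i \<noteq> 0" "X differentiable (at u)"
  shows "inj (frechet_derivative X (at u))"
proof (rule injI)
  let ?D = "frechet_derivative X (at u)"
  have lin: "linear ?D" by (rule linear_frechet_derivative[OF assms(3)])
  have D: "?D h = (\<Sum>i\<in>UNIV. h $ i *\<^sub>R partial_deriv i X u)" for h
  proof -
    have "?D (\<Sum>i\<in>UNIV. h $ i *\<^sub>R axis i 1) = (\<Sum>i\<in>UNIV. h $ i *\<^sub>R partial_deriv i X u)"
      by (simp add: linear_sum[OF lin] linear_cmul[OF lin] partial_deriv_def)
    moreover have "(\<Sum>i\<in>UNIV. h $ i *\<^sub>R axis i 1) = h"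
      using basis_expansion[of h] by (simp add: scalar_mult_eq_scaleR)
    ultimately show ?thesis by simp
  qed
  show "h = k" if "?D h = ?D k" for h k
    using diagonal_frame_cancel[OF assms(1,2), of "\<lambda>i. h $ i" "\<lambda>i. k $ i"] that
    unfolding D vec_eq_iff by blast
qed

lemma gradient_diagonal:
  assumes "metric X u = diag_matrix g" "\<And>i. g $ i \<noteq> 0"
  shows "gradient X \<phi> u $ i = partial_deriv i \<phi> u / g $ i"
proof -
  have "(\<Sum>j\<in>UNIV. diag_matrix (\<chi> i. 1 / g $ i) $ i $ j * partial_deriv j \<phi> u)
      = (\<Sum>j\<in>UNIV. if i = j then partial_deriv i \<phi> u / g $ i else 0)"
    by (rule sum.cong) auto
  then show ?thesis
    by (simp add: gradient_def assms(1) matrix_inv_diag_matrix[OF assms(2)] matrix_vector_mult_def)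
qed

text \<open>A diagonal inverse metric leaves only the summand \<open>m = i\<close>, and there two of
  the three derivative terms cancel by symmetry of the metric.\<close>

lemma christoffel_diagonal:
  assumes "metric X u = diag_matrix g" "\<And>i. g $ i \<noteq> 0"
  shows "christoffel X u i i k = partial_deriv k (\<lambda>v. metric X v $ i $ i) u / (2 * g $ i)"
proof -
  have "(\<lambda>v. metric X v $ k $ i) = (\<lambda>v. metric X v $ i $ k)"
    by (simp add: metric_def lorentz_commute)
  then have "(\<Sum>m\<in>UNIV. matrix_inv (metric X u) $ i $ m *
        (partial_deriv i (\<lambda>v. metric X v $ k $ m) u + partial_deriv k (\<lambda>v. metric X v $ i $ m) u
         - partial_deriv m (\<lambda>v. metric X v $ i $ k) u))
      = (\<Sum>m\<in>UNIV. if i = m then partial_deriv k (\<lambda>v. metric X v $ i $ i) u / g $ i else 0)"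
    by (intro sum.cong) (auto simp: assms(1) matrix_inv_diag_matrix[OF assms(2)])
  then show ?thesis by (simp add: christoffel_def)
qed

text \<open>A trace against a diagonal matrix reads only these entries. Diagonality is required on
  all of \<open>U\<close> because gradient and metric are both differentiated at
  \<open>u\<close>.\<close>

lemma hessian_diagonal:
  assumes "open U" "u \<in> U" "\<And>v. v \<in> U \<Longrightarrow> metric X v = diag_matrix (g v)"
    and "\<And>v i. v \<in> U \<Longrightarrow> g v $ i \<noteq> 0"
  shows "hessian X \<phi> u $ i $ i = partial_deriv i (\<lambda>v. partial_deriv i \<phi> v / g v $ i) u
    + (\<Sum>k\<in>UNIV. partial_deriv k (\<lambda>v. g v $ i) u / (2 * g u $ i) * (partial_deriv k \<phi> u / g u $ k))"
proof -
  note met = assms(3,4)[OF assms(2)]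
  have "partial_deriv i (\<lambda>v. gradient X \<phi> v $ i) u = partial_deriv i (\<lambda>v. partial_deriv i \<phi> v / g v $ i) u"
    by (rule partial_deriv_cong[OF assms(1,2)]) (rule gradient_diagonal[OF assms(3,4)])
  moreover have "partial_deriv k (\<lambda>v. metric X v $ i $ i) u = partial_deriv k (\<lambda>v. g v $ i) u" for k
    by (rule partial_deriv_cong[OF assms(1,2)]) (simp add: assms(3))
  ultimately show ?thesis
    by (simp add: hessian_def christoffel_diagonal[OF met] gradient_diagonal[OF met])
qed

subsection \<open>The rotational hypersurface\<close>

lemma vector_4 [simp]:
  "(vector [x, y, z, w] :: 'a::zero^4) $ 1 = x"
  "(vector [x, y, z, w] :: 'a::zero^4) $ 2 = y"
  "(vector [x, y, z, w] :: 'a::zero^4) $ 3 = z"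
  "(vector [x, y, z, w] :: 'a::zero^4) $ 4 = w"
  unfolding vector_def by simp_all

lemma partial_deriv_vec_separable:
  fixes u :: "real^3" and F :: "real^3 \<Rightarrow> real^'n" and a b c :: "real \<Rightarrow> real^'n"
  assumes "open U" "u \<in> U" "F differentiable (at u)"
    and F: "\<And>v i. v \<in> U \<Longrightarrow> F v $ i = a (v $ 1) $ i * b (v $ 2) $ i * c (v $ 3) $ i"
    and a: "\<And>i. ((\<lambda>x. a x $ i) has_real_derivative a' $ i) (at (u $ 1))"
    and b: "\<And>i. ((\<lambda>x. b x $ i) has_real_derivative b' $ i) (at (u $ 2))"
    and c: "\<And>i. ((\<lambda>x. c x $ i) has_real_derivative c' $ i) (at (u $ 3))"
  shows "partial_deriv 1 F u = (\<chi> i. a' $ i * b (u $ 2) $ i * c (u $ 3) $ i)"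
    and "partial_deriv 2 F u = (\<chi> i. a (u $ 1) $ i * b' $ i * c (u $ 3) $ i)"
    and "partial_deriv 3 F u = (\<chi> i. a (u $ 1) $ i * b (u $ 2) $ i * c' $ i)"
  unfolding vec_eq_iff
  by (simp_all add: partial_deriv_vec_nth[OF assms(3)] partial_deriv_separable[OF assms(1,2) F a b c])

text \<open>Used as a rewrite rule that eliminates squares of \<open>sin\<close>. The variant after
  it catches the same square inside a longer product.\<close>

lemma sin_mult_sin: "sin x * sin x = 1 - cos x * cos x" for x :: real
  using sin_squared_eq[of x] by (simp add: power2_eq_square)

lemma sin_mult_sin_left: "sin x * (sin x * y) = y - cos x * (cos x * y)" for x y :: real
  using arg_cong[OF sin_mult_sin[of x], of "\<lambda>z. z * y"] by (simp add: algebra_simps)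

text \<open>
  With \<open>p\<close>, \<open>q\<close>, \<open>r\<close> the first three derivatives of \<open>f\<close>, the numbers \<open>a1\<close>, \<open>a2\<close> are the first two
  derivatives of the radial factor of \<open>N\<close>: of \<open>1 / W\<close> along the axis, of \<open>p / W\<close> on the sphere.
\<close>

lemma radial_identity_axis:
  fixes p q r s W :: real
  assumes p: "p\<^sup>2 = W\<^sup>2 + 1" and nz: "s \<noteq> 0" "W \<noteq> 0"
  defines "a1 \<equiv> - (q / W ^ 3) * p"
    and "a2 \<equiv> - (r / W ^ 3 - 3 * p * q\<^sup>2 / W ^ 5) * p - q / W ^ 3 * q"
  shows "p\<^sup>2 / (s\<^sup>2 * W\<^sup>2) * (- a2 / W\<^sup>2 + p * q * a1 / W ^ 4) + p * q / (s * W ^ 4) * (2 * a1 / (s * W\<^sup>2))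
    = (2 * q * (p * W ^ 4 - s * (2 * p\<^sup>2 + 1) * q) + s * W\<^sup>2 * p * r) / (s ^ 3 * W ^ 8) * (1 / W)
      + (s * W\<^sup>2 * p * r - (2 * p * W\<^sup>2 + s * (3 * p\<^sup>2 + 2) * q) * q) / (s ^ 3 * W ^ 7)" (is "?l = ?r")
proof -
  have "?l = s * p\<^sup>2 * (p * r * W\<^sup>2 - 3 * p\<^sup>2 * q\<^sup>2 + q\<^sup>2 * W\<^sup>2 - p\<^sup>2 * q\<^sup>2 - 2 * q\<^sup>2) / (s ^ 3 * W ^ 9)"
    unfolding a1_def a2_def using nz by (simp add: field_simps power_numeral_reduce)
  \<comment> \<open>Over the common denominator \<open>s ^ 3 * W ^ 9\<close> the numerators agree
    only modulo \<open>p\<^sup>2 = W\<^sup>2 + 1\<close>, and this is the step that invokes the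
    relation.\<close>
  also have "p\<^sup>2 * (p * r * W\<^sup>2 - 3 * p\<^sup>2 * q\<^sup>2 + q\<^sup>2 * W\<^sup>2 - p\<^sup>2 * q\<^sup>2 - 2 * q\<^sup>2)
     = W\<^sup>2 * p * r * (1 + W\<^sup>2) - 2 * (2 * p\<^sup>2 + 1) * q\<^sup>2 - (3 * p\<^sup>2 + 2) * q\<^sup>2 * W\<^sup>2"
    using p by algebra
  then have "s * p\<^sup>2 * (p * r * W\<^sup>2 - 3 * p\<^sup>2 * q\<^sup>2 + q\<^sup>2 * W\<^sup>2 - p\<^sup>2 * q\<^sup>2 - 2 * q\<^sup>2) =
     s * (W\<^sup>2 * p * r * (1 + W\<^sup>2) - 2 * (2 * p\<^sup>2 + 1) * q\<^sup>2 - (3 * p\<^sup>2 + 2) * q\<^sup>2 * W\<^sup>2)"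
    by simp
  also have "\<dots> / (s ^ 3 * W ^ 9) = ?r"
    using nz by (simp add: field_simps power_numeral_reduce)
  finally show ?thesis .
qed

lemma radial_identity_sphere:
  fixes p q r s W :: real
  assumes nz: "s \<noteq> 0" "W \<noteq> 0"
  defines "a1 \<equiv> - (q / W ^ 3)" and "a2 \<equiv> - (r / W ^ 3 - 3 * p * q\<^sup>2 / W ^ 5)"
  shows "p\<^sup>2 / (s\<^sup>2 * W\<^sup>2) * (- a2 / W\<^sup>2 + p * q * a1 / W ^ 4)
      - p * q / (s * W ^ 4) * (p / W / s\<^sup>2 * (- 2) - 2 * a1 / (s * W\<^sup>2))
    = (2 * q * (p * W ^ 4 - s * (2 * p\<^sup>2 + 1) * q) + s * W\<^sup>2 * p * r) / (s ^ 3 * W ^ 8) * (p / W)" (is "?l = ?r")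
proof -
  \<comment> \<open>Here \<open>p\<close> and \<open>W\<close> may be independent: the relation
    between them has already been spent on simplifying the derivative of \<open>p / W\<close> to
    \<open>a1\<close>.\<close>
  have "?l = (s * p\<^sup>2 * (r * W\<^sup>2 - 4 * p * q\<^sup>2) + 2 * p\<^sup>2 * q * W ^ 4 - 2 * s * p * q\<^sup>2) / (s ^ 3 * W ^ 9)"
    unfolding a1_def a2_def using nz by (simp add: field_simps power_numeral_reduce)
  also have "\<dots> = ?r"
    using nz by (simp add: field_simps power_numeral_reduce)
  finally show ?thesis .
qed

section \<open>The profile curve and the parameter domain\<close>

locale rotational_profile =
  fixes I :: "real set" and f :: "real \<Rightarrow> real"
  assumes open_I: "open I" and zero_notin_I: "0 \<notin> I" and smooth_f: "smooth_on I f"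
    and deriv_f_gt: "\<And>s. s \<in> I \<Longrightarrow> (deriv f s)\<^sup>2 > 1"
begin

abbreviation "f1 \<equiv> deriv f"
abbreviation "f2 \<equiv> (deriv ^^ 2) f"
abbreviation "f3 \<equiv> (deriv ^^ 3) f"

definition W :: "real \<Rightarrow> real" where
  "W s = sqrt ((f1 s)\<^sup>2 - 1)"

lemma W_pos: "s \<in> I \<Longrightarrow> W s > 0"
  using deriv_f_gt by (simp add: W_def)

lemma W_square: "s \<in> I \<Longrightarrow> (W s)\<^sup>2 = (f1 s)\<^sup>2 - 1"
  using deriv_f_gt[of s] by (simp add: W_def)

lemma smooth_derivs: "smooth_on I f1" "smooth_on I f2" "smooth_on I f3"
  using smooth_on_deriv[OF open_I] smooth_f by (simp_all add: numeral_2_eq_2 numeral_3_eq_3)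

lemma f_derivs:
  assumes "s \<in> I"
  shows "(f has_real_derivative f1 s) (at s)" "(f1 has_real_derivative f2 s) (at s)"
    "(f2 has_real_derivative f3 s) (at s)"
  using smooth_on_has_deriv[OF smooth_f assms] smooth_on_has_deriv[OF smooth_derivs(1) assms]
    smooth_on_has_deriv[OF smooth_derivs(2) assms]
  by (simp_all add: numeral_2_eq_2 numeral_3_eq_3)

lemma W_deriv:
  assumes "s \<in> I"
  shows "(W has_real_derivative f1 s * f2 s / W s) (at s)"
proof -
  have "((\<lambda>s. sqrt ((f1 s)\<^sup>2 - 1)) has_real_derivative f1 s * f2 s / sqrt ((f1 s)\<^sup>2 - 1)) (at s)"
    using deriv_f_gt[OF assms]
    by (auto intro!: derivative_eq_intros f_derivs[OF assms] simp: field_simps)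
  then show ?thesis by (simp add: W_def[abs_def])
qed

lemma smooth_W: "smooth_on I W"
  unfolding W_def[abs_def]
  by (intro smooth_on_sqrt smooth_on_diff smooth_on_power smooth_on_const open_I smooth_derivs)
    (use deriv_f_gt in simp)

abbreviation "U \<equiv> rot_domain I"

lemma open_U: "open U"
proof -
  have "open ((\<lambda>u::real^3. u $ 1) -` I)"
    by (intro open_vimage open_I continuous_intros)
  moreover have "open {u::real^3. cos (u $ 2) \<noteq> 0}"
    by (intro open_Collect_neq continuous_intros)
  ultimately have "open ((\<lambda>u::real^3. u $ 1) -` I \<inter> {u. cos (u $ 2) \<noteq> 0})" by (rule open_Int)
  also have "(\<lambda>u::real^3. u $ 1) -` I \<inter> {u. cos (u $ 2) \<noteq> 0} = U"
    by (auto simp: rot_domain_def)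
  finally show ?thesis .
qed

lemma U_D: "u \<in> U \<Longrightarrow> u $ 1 \<in> I" "u \<in> U \<Longrightarrow> cos (u $ 2) \<noteq> 0"
  "u \<in> U \<Longrightarrow> u $ 1 \<noteq> 0" "u \<in> U \<Longrightarrow> W (u $ 1) \<noteq> 0"
  using zero_notin_I W_pos[of "u $ 1"] by (auto simp: rot_domain_def)

section \<open>Separation of the immersion and the Gauss map into radial and angular factors\<close>

abbreviation "X \<equiv> rot_hypersurface f"
abbreviation "N \<equiv> rot_gauss_map f"

text \<open>Componentwise, \<open>lat t\<close> times \<open>lon w\<close> is 1 on the axis and the
  unit sphere point (cos t sin w, sin t, cos t cos w) elsewhere. The signs of the parametrization
  are kept in the radial factors \<open>profX\<close> and \<open>profN\<close>.\<close>

definition lat :: "real \<Rightarrow> real^4" where "lat t = vector [1, cos t, sin t, cos t]"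
definition lat' :: "real \<Rightarrow> real^4" where "lat' t = vector [0, - sin t, cos t, - sin t]"
definition lat'' :: "real \<Rightarrow> real^4" where "lat'' t = vector [0, - cos t, - sin t, - cos t]"
definition lon :: "real \<Rightarrow> real^4" where "lon w = vector [1, sin w, 1, cos w]"
definition lon' :: "real \<Rightarrow> real^4" where "lon' w = vector [0, cos w, 0, - sin w]"
definition lon'' :: "real \<Rightarrow> real^4" where "lon'' w = vector [0, - sin w, 0, - cos w]"

definition profX :: "real \<Rightarrow> real^4" where "profX s = vector [f s, - s, - s, s]"
definition profX' :: "real \<Rightarrow> real^4" where "profX' s = vector [f1 s, - 1, - 1, 1]"
definition profN :: "real \<Rightarrow> real^4" where
  "profN s = vector [1 / W s, - (f1 s / W s), - (f1 s / W s), f1 s / W s]"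
text \<open>Writing the derivative as a multiple of \<open>profX'\<close> exposes the first
  principal curvature: the factor is its negative.\<close>

definition profN' :: "real \<Rightarrow> real^4" where
  "profN' s = (- (f2 s / W s ^ 3)) *\<^sub>R profX' s"
definition profN'' :: "real \<Rightarrow> real^4" where
  "profN'' s = (- (f3 s / W s ^ 3 - 3 * f1 s * (f2 s)\<^sup>2 / W s ^ 5)) *\<^sub>R profX' s
     + (- (f2 s / W s ^ 3)) *\<^sub>R vector [f2 s, 0, 0, 0]"

lemma lat_derivs:
  "((\<lambda>t. lat t $ i) has_real_derivative lat' t $ i) (at t)"
  "((\<lambda>t. lat' t $ i) has_real_derivative lat'' t $ i) (at t)"
  using exhaust_4[of i]
  by (auto simp: lat_def lat'_def lat''_def intro!: derivative_eq_intros)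

lemma lon_derivs:
  "((\<lambda>w. lon w $ i) has_real_derivative lon' w $ i) (at w)"
  "((\<lambda>w. lon' w $ i) has_real_derivative lon'' w $ i) (at w)"
  using exhaust_4[of i]
  by (auto simp: lon_def lon'_def lon''_def intro!: derivative_eq_intros)

lemma profX_deriv: "s \<in> I \<Longrightarrow> ((\<lambda>s. profX s $ i) has_real_derivative profX' s $ i) (at s)"
  using exhaust_4[of i]
  by (auto simp: profX_def profX'_def intro!: derivative_eq_intros f_derivs)

lemma profN_derivs:
  assumes s: "s \<in> I"
  shows "((\<lambda>s. profN s $ i) has_real_derivative profN' s $ i) (at s)"
    and "((\<lambda>s. profN' s $ i) has_real_derivative profN'' s $ i) (at s)"
proof -
  note W = W_pos[OF s, THEN less_imp_neq, symmetric]
  have 1: "((\<lambda>s. 1 / W s) has_real_derivative - (f1 s * f2 s / W s ^ 3)) (at s)"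
    using W by (auto intro!: derivative_eq_intros W_deriv[OF s] simp: field_simps power3_eq_cube power2_eq_square)
  \<comment> \<open>The numerator of the quotient rule collapses because
    \<open>(W s)\<^sup>2 - (f1 s)\<^sup>2\<close> equals -1.\<close>
  have "f2 s * W s - f1 s * (f1 s * f2 s / W s) = - (f2 s / W s)"
  proof -
    have "f2 s * W s - f1 s * (f1 s * f2 s / W s) = f2 s * ((W s)\<^sup>2 - (f1 s)\<^sup>2) / W s"
      using W by (simp add: field_simps power2_eq_square)
    then show ?thesis by (simp add: W_square[OF s])
  qed
  with DERIV_divide[OF f_derivs(2)[OF s] W_deriv[OF s] W]
  have 2: "((\<lambda>s. f1 s / W s) has_real_derivative - (f2 s / W s ^ 3)) (at s)"
    by (simp add: power3_eq_cube mult.assoc)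
  show "((\<lambda>s. profN s $ i) has_real_derivative profN' s $ i) (at s)"
    using exhaust_4[of i] 1 2 DERIV_minus[OF 2]
    by (auto simp: profN_def profN'_def profX'_def mult.commute)
  have 3: "((\<lambda>s. - (f2 s / W s ^ 3)) has_real_derivative
      - (f3 s / W s ^ 3 - 3 * f1 s * (f2 s)\<^sup>2 / W s ^ 5)) (at s)"
    using W by (auto intro!: derivative_eq_intros W_deriv[OF s] f_derivs[OF s]
        simp: field_simps power2_eq_square power_numeral_reduce)
  have 4: "((\<lambda>s. profX' s $ i) has_real_derivative (vector [f2 s, 0, 0, 0] :: real^4) $ i) (at s)"
    using exhaust_4[of i] by (auto simp: profX'_def intro!: derivative_eq_intros f_derivs[OF s])
  show "((\<lambda>s. profN' s $ i) has_real_derivative profN'' s $ i) (at s)"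
    using DERIV_mult[OF 3 4] by (simp add: profN'_def profN''_def mult_ac)
qed

lemma X_separable: "X v $ i = profX (v $ 1) $ i * lat (v $ 2) $ i * lon (v $ 3) $ i"
  using exhaust_4[of i] by (auto simp: rot_hypersurface_def Let_def profX_def lat_def lon_def)

lemma N_separable: "N v $ i = profN (v $ 1) $ i * lat (v $ 2) $ i * lon (v $ 3) $ i"
  using exhaust_4[of i] by (auto simp: rot_gauss_map_def Let_def profN_def lat_def lon_def W_def)

lemma smooth_on_nth: "smooth_on U (\<lambda>u. u $ i)"
  by (rule smooth_on_bounded_linear[OF open_U bounded_linear_vec_nth])

lemma smooth_on_profile:
  fixes h :: "real \<Rightarrow> real"
  shows "smooth_on I h \<Longrightarrow> smooth_on U (\<lambda>u. h (u $ 1))"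
  by (rule smooth_on_compose[where V = I and h = h and g = "\<lambda>u. u $ 1", OF open_U])
    (auto intro: smooth_on_nth U_D)

lemma smooth_lat_lon: "smooth_on U (\<lambda>u. lat (u $ 2) $ i)" "smooth_on U (\<lambda>u. lon (u $ 3) $ i)"
  using exhaust_4[of i]
  by (auto simp: lat_def lon_def intro!: smooth_on_const smooth_on_sin smooth_on_cos smooth_on_nth open_U)

lemma smooth_ident: "smooth_on I (\<lambda>s. s)"
  by (rule smooth_on_bounded_linear[OF open_I bounded_linear_ident])

lemma smooth_X: "smooth_on U X"
proof (rule smooth_on_vec_nthI[OF open_U])
  fix i
  have "smooth_on I (\<lambda>s. profX s $ i)"
    using exhaust_4[of i] smooth_f smooth_ident smooth_on_minus[OF open_I smooth_ident]
    by (auto simp: profX_def)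
  then show "smooth_on U (\<lambda>v. X v $ i)"
    unfolding X_separable by (intro smooth_on_mult open_U smooth_lat_lon smooth_on_profile)
qed

lemma smooth_N: "smooth_on U N"
proof (rule smooth_on_vec_nthI[OF open_U])
  fix i
  have "smooth_on I (\<lambda>s. 1 / W s)" and h: "smooth_on I (\<lambda>s. f1 s / W s)"
    by (rule smooth_on_divide; use W_pos open_I smooth_W smooth_derivs smooth_on_const in force)+
  then have "smooth_on I (\<lambda>s. profN s $ i)"
    using exhaust_4[of i] smooth_on_minus[OF open_I h] by (auto simp: profN_def)
  then show "smooth_on U (\<lambda>v. N v $ i)"
    unfolding N_separable by (intro smooth_on_mult open_U smooth_lat_lon smooth_on_profile)
qed

section \<open>Metric, shape operator and orientation\<close>

lemma partial_derivs_X: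
  assumes u: "u \<in> U"
  shows "partial_deriv 1 X u = (\<chi> i. profX' (u $ 1) $ i * lat (u $ 2) $ i * lon (u $ 3) $ i)"
    and "partial_deriv 2 X u = (\<chi> i. profX (u $ 1) $ i * lat' (u $ 2) $ i * lon (u $ 3) $ i)"
    and "partial_deriv 3 X u = (\<chi> i. profX (u $ 1) $ i * lat (u $ 2) $ i * lon' (u $ 3) $ i)"
  by (rule partial_deriv_vec_separable[OF open_U u smooth_on_differentiable[OF smooth_X u]
        X_separable profX_deriv[OF U_D(1)[OF u]] lat_derivs(1) lon_derivs(1)])+

lemma partial_derivs_N:
  assumes u: "u \<in> U"
  shows "partial_deriv 1 N u = (\<chi> i. profN' (u $ 1) $ i * lat (u $ 2) $ i * lon (u $ 3) $ i)"
    and "partial_deriv 2 N u = (\<chi> i. profN (u $ 1) $ i * lat' (u $ 2) $ i * lon (u $ 3) $ i)"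
    and "partial_deriv 3 N u = (\<chi> i. profN (u $ 1) $ i * lat (u $ 2) $ i * lon' (u $ 3) $ i)"
  by (rule partial_deriv_vec_separable[OF open_U u smooth_on_differentiable[OF smooth_N u]
        N_separable profN_derivs(1)[OF U_D(1)[OF u]] lat_derivs(1) lon_derivs(1)])+

definition gram_diag :: "real^3 \<Rightarrow> real^3" where
  "gram_diag v = vector [- (W (v $ 1))\<^sup>2, (v $ 1)\<^sup>2, (v $ 1)\<^sup>2 * (cos (v $ 2))\<^sup>2]"

lemma G_nonzero: "u \<in> U \<Longrightarrow> gram_diag u $ i \<noteq> 0"
  using exhaust_3[of i] U_D[of u] by (auto simp: gram_diag_def)

lemma metric_X:
  assumes u: "u \<in> U"
  shows "metric X u = diag_matrix (gram_diag u)"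
proof -
  have "metric X u $ i $ j = diag_matrix (gram_diag u) $ i $ j" for i j
    using exhaust_3[of i] exhaust_3[of j]
    by (elim disjE; hypsubst)
      (simp_all add: metric_def partial_derivs_X[OF u] lorentz_def profX_def profX'_def lat_def
        lat'_def lon_def lon'_def gram_diag_def W_square[OF U_D(1)[OF u], unfolded power2_eq_square]
        algebra_simps power2_eq_square sin_mult_sin sin_mult_sin_left)
  then show ?thesis by (simp add: vec_eq_iff)
qed

lemma shape_operator_X:
  assumes u: "u \<in> U"
  defines "s \<equiv> u $ 1"
  shows "shape_operator X N u = diag_matrix (vector [f2 s / W s ^ 3, - (f1 s / (s * W s)), - (f1 s / (s * W s))])"
    (is "_ = diag_matrix ?d")
proof (rule shape_operator_diagonal[OF metric_X[OF u] G_nonzero[OF u]])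
  fix j :: 3
  \<comment> \<open>\<open>profN\<close> and \<open>profX\<close> are proportional except in the
    axial component, where \<open>lat'\<close> and \<open>lon'\<close> vanish. The ratio is minus
    the repeated principal curvature.\<close>
  have "profN s $ i * lat' (u $ 2) $ i * c = f1 s / (s * W s) * (profX s $ i * lat' (u $ 2) $ i * c)"
    "profN s $ i * c * lon' (u $ 3) $ i = f1 s / (s * W s) * (profX s $ i * c * lon' (u $ 3) $ i)" for i c
    using exhaust_4[of i] U_D(3)[OF u]
    by (auto simp: profN_def profX_def lat'_def lon'_def s_def)
  then show "- partial_deriv j N u = ?d $ j *\<^sub>R partial_deriv j X u"
    using exhaust_3[of j]
    by (auto simp: partial_derivs_X[OF u] partial_derivs_N[OF u] vec_eq_iff profN'_def s_def)
qed

lemma oriented_hypersurface_X: "oriented_hypersurface U X N"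
proof -
  have orth: "lorentz (N u) (partial_deriv j X u) = 0" if u: "u \<in> U" for u j
    using exhaust_3[of j] U_D[OF u]
    by (auto simp: sin_mult_sin sin_mult_sin_left lorentz_def partial_derivs_X[OF u] N_separable
        profN_def profX_def profX'_def lat_def lat'_def lon_def lon'_def field_simps)
  \<comment> \<open>The normal is spacelike, so \<epsilon> = 1, while the \<open>s\<close> direction
    is timelike.\<close>
  have unit: "lorentz (N u) (N u) = 1" if u: "u \<in> U" for u
  proof -
    have "lorentz (N u) (N u) = ((f1 (u $ 1))\<^sup>2 - 1) / (W (u $ 1))\<^sup>2"
      using U_D(4)[OF u]
      by (simp add: lorentz_def N_separable profN_def lat_def lon_def sin_mult_sin
          sin_mult_sin_left field_simps power2_eq_square)
    then show ?thesis using U_D(4)[OF u] by (simp flip: W_square[OF U_D(1)[OF u]])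
  qed
  have "inj (frechet_derivative X (at u))" "det (metric X u) \<noteq> 0" if "u \<in> U" for u
    using that inj_frechet_derivative_diagonal[OF metric_X[OF that] G_nonzero[OF that]
        smooth_on_differentiable[OF smooth_X that]] G_nonzero
    by (auto simp: metric_X det_diag_matrix)
  then show ?thesis
    using open_U smooth_X smooth_N orth unit by (auto simp: oriented_hypersurface_def)
qed

text \<open>The expression in \<open>B''\<close>, \<open>C''\<close> and \<open>B'\<close> is the
  Laplacian of the unit sphere applied to the angular factor, in latitude and longitude. The two
  outer coefficients come from products of principal curvatures, the entries of
  \<open>P\<^sub>2\<close>.\<close>

lemma L_op_separable:
  fixes A A' B B' C C' :: "real \<Rightarrow> real"
  assumes u: "u \<in> U"
    and \<phi>: "\<And>v. v \<in> U \<Longrightarrow> \<phi> v = A (v $ 1) * B (v $ 2) * C (v $ 3)"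
    and A: "\<And>s. s \<in> I \<Longrightarrow> (A has_real_derivative A' s) (at s)"
      "(A' has_real_derivative A'') (at (u $ 1))"
    and B: "\<And>t. (B has_real_derivative B' t) (at t)" "(B' has_real_derivative B'') (at (u $ 2))"
    and C: "\<And>w. (C has_real_derivative C' w) (at w)" "(C' has_real_derivative C'') (at (u $ 3))"
  defines "s \<equiv> u $ 1" and "t \<equiv> u $ 2" and "w \<equiv> u $ 3"
  shows "L_op 2 X N \<phi> u =
    (f1 s)\<^sup>2 / (s\<^sup>2 * (W s)\<^sup>2) * (- A'' / (W s)\<^sup>2 + f1 s * f2 s * A' s / W s ^ 4) * (B t * C w)
    - f1 s * f2 s / (s * W s ^ 4) *
      (A s / s\<^sup>2 * (B'' * C w + B t * C'' / (cos t)\<^sup>2 - sin t / cos t * B' t * C w)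
        - 2 * A' s / (s * (W s)\<^sup>2) * (B t * C w))"
proof -
  note uI = U_D[OF u]
  have s: "s \<in> I" "s \<noteq> 0" "W s \<noteq> 0" and t: "cos t \<noteq> 0" using uI by (simp_all add: s_def t_def)
  have one: "((\<lambda>_. 1) has_real_derivative 0) (at x)" for x :: real by simp
  have \<phi>': "partial_deriv 1 \<phi> v = A' (v $ 1) * B (v $ 2) * C (v $ 3)"
    "partial_deriv 2 \<phi> v = A (v $ 1) * B' (v $ 2) * C (v $ 3)"
    "partial_deriv 3 \<phi> v = A (v $ 1) * B (v $ 2) * C' (v $ 3)" if "v \<in> U" for v
    by (rule partial_deriv_separable[OF open_U that \<phi> A(1)[OF U_D(1)[OF that]] B(1) C(1)]; assumption)+
  have W2: "((\<lambda>s. - (W s)\<^sup>2) has_real_derivative - (2 * f1 s * f2 s)) (at (u $ 1))"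
    using s by (auto intro!: derivative_eq_intros W_deriv simp: s_def)
  have s2: "((\<lambda>s. s\<^sup>2) has_real_derivative 2 * s) (at (u $ 1))"
    by (auto intro!: derivative_eq_intros simp: s_def)
  have c2: "((\<lambda>t. (cos t)\<^sup>2) has_real_derivative - (2 * sin t * cos t)) (at (u $ 2))"
    by (auto intro!: derivative_eq_intros simp: t_def)
  have G1: "gram_diag v $ 1 = - (W (v $ 1))\<^sup>2 * 1 * 1" and G2: "gram_diag v $ 2 = (v $ 1)\<^sup>2 * 1 * 1"
    and G3: "gram_diag v $ 3 = (v $ 1)\<^sup>2 * (cos (v $ 2))\<^sup>2 * 1" for v
    by (simp_all add: gram_diag_def)
  note dG1 = partial_deriv_separable[OF open_U u G1 W2 one one]
  note dG2 = partial_deriv_separable[OF open_U u G2 s2 one one]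
  note dG3 = partial_deriv_separable[OF open_U u G3 s2 c2 one]
  have q1: "((\<lambda>s. A' s / (- (W s)\<^sup>2)) has_real_derivative
      - A'' / (W s)\<^sup>2 + 2 * f1 s * f2 s * A' s / W s ^ 4) (at (u $ 1))"
    using s by (intro DERIV_cong[OF DERIV_divide[OF A(2) W2]]) (simp_all add: s_def field_simps power_numeral_reduce)
  \<comment> \<open>In \<open>h2\<close> and \<open>h3\<close> the radial factor is a spectator;
    \<open>q3\<close> supplies the differentiability that \<open>partial_deriv_separable\<close>
    asks of it.\<close>
  have q3: "((\<lambda>s. A s / s\<^sup>2) has_real_derivative A' s / s\<^sup>2 - 2 * A s / s ^ 3) (at (u $ 1))"
    using s by (intro DERIV_cong[OF DERIV_divide[OF A(1) s2]]) (simp_all add: s_def field_simps power_numeral_reduce)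
  have bc: "((\<lambda>t. B t / (cos t)\<^sup>2) has_real_derivative
      (B' t * (cos t)\<^sup>2 + 2 * sin t * cos t * B t) / cos t ^ 4) (at (u $ 2))"
    using t by (intro DERIV_cong[OF DERIV_divide[OF B(1) c2]]) (simp_all add: t_def field_simps power_numeral_reduce)
  have h1: "partial_deriv 1 (\<lambda>v. partial_deriv 1 \<phi> v / gram_diag v $ 1) u
      = (- A'' / (W s)\<^sup>2 + 2 * f1 s * f2 s * A' s / W s ^ 4) * B t * C w"
    unfolding t_def w_def
    by (rule partial_deriv_separable(1)[OF open_U u _ q1 B(1) C(1)]) (simp add: \<phi>' G1)
  have h2: "partial_deriv 2 (\<lambda>v. partial_deriv 2 \<phi> v / gram_diag v $ 2) u = A s / s\<^sup>2 * B'' * C w"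
    unfolding s_def w_def
    by (rule partial_deriv_separable(2)[OF open_U u _ q3 B(2) C(1)]) (simp add: \<phi>' G2)
  have h3: "partial_deriv 3 (\<lambda>v. partial_deriv 3 \<phi> v / gram_diag v $ 3) u = A s / s\<^sup>2 * (B t / (cos t)\<^sup>2) * C''"
    unfolding s_def t_def
    by (rule partial_deriv_separable(3)[OF open_U u _ q3 bc C(2)]) (simp add: \<phi>' G3)
  have hess: "hessian X \<phi> u $ i $ i = partial_deriv i (\<lambda>v. partial_deriv i \<phi> v / gram_diag v $ i) u
    + (\<Sum>k\<in>UNIV. partial_deriv k (\<lambda>v. gram_diag v $ i) u / (2 * gram_diag u $ i)
        * (partial_deriv k \<phi> u / gram_diag u $ k))" for i
    by (rule hessian_diagonal[OF open_U u]) (simp_all add: metric_X G_nonzero)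
  \<comment> \<open>The Christoffel term cancels one of the two copies of
    \<open>f1 s * f2 s * A' s / W s ^ 4\<close> in \<open>h1\<close>.\<close>
  have H1: "hessian X \<phi> u $ 1 $ 1 = (- A'' / (W s)\<^sup>2 + f1 s * f2 s * A' s / W s ^ 4) * (B t * C w)"
    unfolding hess h1 sum_3 dG1 \<phi>'[OF u] using s
    by (simp add: G1 s_def[symmetric] t_def[symmetric] w_def[symmetric] field_simps power_numeral_reduce)
  have H2: "hessian X \<phi> u $ 2 $ 2 = A s / s\<^sup>2 * B'' * C w - A' s / (s * (W s)\<^sup>2) * (B t * C w)"
    unfolding hess h2 sum_3 dG2 \<phi>'[OF u] using s
    by (simp add: G1 G2 G3 s_def[symmetric] t_def[symmetric] w_def[symmetric] field_simps power_numeral_reduce)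
  have H3: "hessian X \<phi> u $ 3 $ 3 = A s / s\<^sup>2 * (B t / (cos t)\<^sup>2) * C'' - A' s / (s * (W s)\<^sup>2) * (B t * C w)
      - sin t / cos t * (A s / s\<^sup>2) * B' t * C w"
    unfolding hess h3 sum_3 dG3 \<phi>'[OF u] using s t
    by (simp add: G1 G2 G3 s_def[symmetric] t_def[symmetric] w_def[symmetric] field_simps power_numeral_reduce)
  have "L_op 2 X N \<phi> u = (f1 s / (s * W s))\<^sup>2 * hessian X \<phi> u $ 1 $ 1
      - f2 s / W s ^ 3 * (f1 s / (s * W s)) * (hessian X \<phi> u $ 2 $ 2 + hessian X \<phi> u $ 3 $ 3)"
    by (simp add: L_op_def shape_operator_X[OF u] newton_transformation_2_diag_matrix
        trace_diag_matrix_mult sum_3 s_def[symmetric] power2_eq_square algebra_simps)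
  also have "(f1 s / (s * W s))\<^sup>2 = (f1 s)\<^sup>2 / (s\<^sup>2 * (W s)\<^sup>2)"
    by (simp add: power_mult_distrib power_divide)
  also have "f2 s / W s ^ 3 * (f1 s / (s * W s)) = f1 s * f2 s / (s * W s ^ 4)"
    by (simp add: power_numeral_reduce mult_ac)
  finally show ?thesis
    unfolding H1 H2 H3 by (simp add: algebra_simps add_divide_distrib diff_divide_distrib)
qed

text \<open>Components with angular eigenvalue -2 produce only a multiple of \<open>N\<close>. The
  axial component, with eigenvalue 0, leaves a remainder, which becomes \<open>n\<close> times
  \<open>C\<^sub>1\<close>.\<close>

lemma L_op_gauss_map_nth:
  assumes u: "u \<in> U"
  defines "s \<equiv> u $ 1"
  shows "L_op 2 X N (\<lambda>v. N v $ i) u =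
    (2 * f2 s * (f1 s * W s ^ 4 - s * (2 * (f1 s)\<^sup>2 + 1) * f2 s) + s * (W s)\<^sup>2 * f1 s * f3 s)
      / (s ^ 3 * W s ^ 8) * N u $ i
    + (if i = 1 then (s * (W s)\<^sup>2 * f1 s * f3 s
        - (2 * f1 s * (W s)\<^sup>2 + s * (3 * (f1 s)\<^sup>2 + 2) * f2 s) * f2 s) / (s ^ 3 * W s ^ 7) else 0)"
proof -
  define t w where "t = u $ 2" and "w = u $ 3"
  have s: "s \<in> I" "s \<noteq> 0" "W s \<noteq> 0" and t: "cos t \<noteq> 0"
    using U_D[OF u] by (simp_all add: s_def t_def)
  have p: "(f1 s)\<^sup>2 = (W s)\<^sup>2 + 1" using W_square[OF s(1)] by simp
  have L: "L_op 2 X N (\<lambda>v. N v $ i) u =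
    (f1 s)\<^sup>2 / (s\<^sup>2 * (W s)\<^sup>2) * (- profN'' s $ i / (W s)\<^sup>2 + f1 s * f2 s * profN' s $ i / W s ^ 4)
      * (lat t $ i * lon w $ i)
    - f1 s * f2 s / (s * W s ^ 4) *
      (profN s $ i / s\<^sup>2 * (lat'' t $ i * lon w $ i + lat t $ i * lon'' w $ i / (cos t)\<^sup>2
          - sin t / cos t * lat' t $ i * lon w $ i)
        - 2 * profN' s $ i / (s * (W s)\<^sup>2) * (lat t $ i * lon w $ i))"
    unfolding s_def t_def w_def
    by (rule L_op_separable[OF u N_separable profN_derivs(1) profN_derivs(2)[OF U_D(1)[OF u]]
      lat_derivs lon_derivs])
  note axis_id = radial_identity_axis[OF p s(2,3), where q = "f2 s" and r = "f3 s"]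
    and sphere_id = radial_identity_sphere[OF s(2,3), where p = "f1 s" and q = "f2 s" and r = "f3 s"]
  show ?thesis
  proof (cases "i = 1")
    case True
    have N: "N u $ i = 1 / W s"
      using True by (simp add: N_separable profN_def lat_def lon_def s_def)
    have P: "profN' s $ i = - (f2 s / W s ^ 3) * f1 s"
      "profN'' s $ i = - (f3 s / W s ^ 3 - 3 * f1 s * (f2 s)\<^sup>2 / W s ^ 5) * f1 s - f2 s / W s ^ 3 * f2 s"
      using True by (simp_all add: profN'_def profN''_def profX'_def)
    have Q: "lat t $ i = 1" "lat' t $ i = 0" "lat'' t $ i = 0" "lon w $ i = 1" "lon'' w $ i = 0"
      using True by (simp_all add: lat_def lat'_def lat''_def lon_def lon''_def)
    show ?thesis
      unfolding L P Q N using True axis_id by simp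
  next
    case False
    \<comment> \<open>Off the axis the radial factor and its derivatives are multiples of
      \<open>profX'\<close>, so \<open>e\<close> collects sign and angular function, and the sphere
      identity gets multiplied by it.\<close>
    define e where "e = profX' s $ i * (lat t $ i * lon w $ i)"
    have N: "N u $ i = f1 s / W s * e"
      using False exhaust_4[of i]
      by (auto simp: N_separable profN_def profX'_def e_def s_def t_def w_def)
    have P: "profN s $ i = f1 s / W s * profX' s $ i"
      "profN' s $ i = - (f2 s / W s ^ 3) * profX' s $ i"
      "profN'' s $ i = - (f3 s / W s ^ 3 - 3 * f1 s * (f2 s)\<^sup>2 / W s ^ 5) * profX' s $ i"
      using False exhaust_4[of i] by (auto simp: profN_def profN'_def profN''_def profX'_def)
    \<comment> \<open>The coordinate functions of the unit sphere are eigenfunctions of its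
      Laplacian with eigenvalue -2.\<close>
    have Q: "lat'' t $ i * lon w $ i + lat t $ i * lon'' w $ i / (cos t)\<^sup>2 - sin t / cos t * lat' t $ i * lon w $ i
        = - 2 * (lat t $ i * lon w $ i)"
      using False exhaust_4[of i] t
      by (auto simp: lat_def lat'_def lat''_def lon_def lon''_def field_simps power2_eq_square
          sin_mult_sin sin_mult_sin_left)
    show ?thesis
      using arg_cong[OF sphere_id, of "\<lambda>x. x * e"] False
      unfolding L P Q N by (simp add: e_def algebra_simps)
  qed
qed

section \<open>The coefficient functions in terms of \<open>W\<close>\<close>

lemma coefficient_eqs:
  assumes s: "s \<in> I"
  shows "(2 * f2 s * (f1 s * ((f1 s)\<^sup>2 - 1)\<^sup>2 - s * (2 * (f1 s)\<^sup>2 + 1) * f2 s) + s * ((f1 s)\<^sup>2 - 1) * f1 s * f3 s)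
      / (s ^ 3 * ((f1 s)\<^sup>2 - 1) ^ 4)
    = (2 * f2 s * (f1 s * W s ^ 4 - s * (2 * (f1 s)\<^sup>2 + 1) * f2 s) + s * (W s)\<^sup>2 * f1 s * f3 s)
      / (s ^ 3 * W s ^ 8)"
    and "((f1 s)\<^sup>2 - 1) powr (7 / 2) = W s ^ 7"
proof -
  have "W s ^ 4 = ((f1 s)\<^sup>2 - 1)\<^sup>2" "W s ^ 8 = ((f1 s)\<^sup>2 - 1) ^ 4"
    by (simp_all flip: W_square[OF s] power_mult)
  then show "(2 * f2 s * (f1 s * ((f1 s)\<^sup>2 - 1)\<^sup>2 - s * (2 * (f1 s)\<^sup>2 + 1) * f2 s) + s * ((f1 s)\<^sup>2 - 1) * f1 s * f3 s)
      / (s ^ 3 * ((f1 s)\<^sup>2 - 1) ^ 4)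
    = (2 * f2 s * (f1 s * W s ^ 4 - s * (2 * (f1 s)\<^sup>2 + 1) * f2 s) + s * (W s)\<^sup>2 * f1 s * f3 s)
      / (s ^ 3 * W s ^ 8)"
    by (simp only: W_square[OF s])
  \<comment> \<open>The half-integer exponent is reached by reading \<open>W\<close> as the power
    1/2 and multiplying exponents.\<close>
  have "W s ^ 7 = W s powr 7" using W_pos[OF s] by (simp add: powr_numeral)
  also have "\<dots> = (((f1 s)\<^sup>2 - 1) powr (1 / 2)) powr 7"
    using deriv_f_gt[OF s] by (simp add: W_def powr_half_sqrt)
  also have "\<dots> = ((f1 s)\<^sup>2 - 1) powr (7 / 2)" by (simp add: powr_powr)
  finally show "((f1 s)\<^sup>2 - 1) powr (7 / 2) = W s ^ 7" ..
qed

text \<open>In terms of \<open>W\<close> both coefficients are quotients of polynomials in smooth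
  functions with nonvanishing denominators, so \<open>powr\<close> need not be
  differentiated.\<close>

lemma smooth_coefficients:
  assumes "c \<noteq> 0"
  shows "smooth_on I (\<lambda>s. (2 * f2 s * (f1 s * W s ^ 4 - s * (2 * (f1 s)\<^sup>2 + 1) * f2 s)
      + s * (W s)\<^sup>2 * f1 s * f3 s) / (s ^ 3 * W s ^ 8))" (is "smooth_on I ?m")
    and "smooth_on I (\<lambda>s. (s * (W s)\<^sup>2 * f1 s * f3 s
      - (2 * f1 s * (W s)\<^sup>2 + s * (3 * (f1 s)\<^sup>2 + 2) * f2 s) * f2 s) / (c * s ^ 3 * W s ^ 7))" (is "smooth_on I ?n")
proof -
  have nz: "s ^ 3 * W s ^ 8 \<noteq> 0" "c * s ^ 3 * W s ^ 7 \<noteq> 0" if "s \<in> I" for s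
    using that W_pos[OF that] zero_notin_I assms by auto
  show "smooth_on I ?m"
    by (rule smooth_on_divide[OF open_I _ _ nz(1)])
      (intro smooth_on_add smooth_on_diff smooth_on_mult smooth_on_power smooth_on_const open_I
        smooth_derivs smooth_W smooth_ident | assumption)+
  show "smooth_on I ?n"
    by (rule smooth_on_divide[OF open_I _ _ nz(2)])
      (intro smooth_on_add smooth_on_diff smooth_on_mult smooth_on_power smooth_on_const open_I
        smooth_derivs smooth_W smooth_ident | assumption)+
qed

end

theorem theorem15:
  fixes I :: "real set" and f m n :: "real \<Rightarrow> real" and C\<^sub>1 :: real
  assumes "open I" and "is_interval I" and "0 \<notin> I"
    and "smooth_on I f"
    and "\<And>s. s \<in> I \<Longrightarrow> (deriv f s)\<^sup>2 > 1"
    and "\<And>s. s \<in> I \<Longrightarrow> (deriv ^^ 2) f s \<noteq> 0"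
    and "C\<^sub>1 \<noteq> 0"
    and "\<And>s. s \<in> I \<Longrightarrow> m s =
      (let f' = deriv f s; f'' = (deriv ^^ 2) f s; f''' = (deriv ^^ 3) f s
       in (2 * f'' * (f' * (f'\<^sup>2 - 1)\<^sup>2 - s * (2 * f'\<^sup>2 + 1) * f'')
             + s * (f'\<^sup>2 - 1) * f' * f''')
          / (s ^ 3 * (f'\<^sup>2 - 1) ^ 4))"
    and "\<And>s. s \<in> I \<Longrightarrow> n s =
      (let f' = deriv f s; f'' = (deriv ^^ 2) f s; f''' = (deriv ^^ 3) f s
       in (s * (f'\<^sup>2 - 1) * f' * f'''
             - (2 * f' * (f'\<^sup>2 - 1) + s * (3 * f'\<^sup>2 + 2) * f'') * f'')
          / (C\<^sub>1 * s ^ 3 * (f'\<^sup>2 - 1) powr (7 / 2)))"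
    and "\<exists>s\<in>I. m s \<noteq> 0" and "\<exists>s\<in>I. n s \<noteq> 0"
  shows "oriented_hypersurface (rot_domain I) (rot_hypersurface f) (rot_gauss_map f)
    \<and> generalized_1_type_Gauss_map 2 (rot_domain I) (rot_hypersurface f) (rot_gauss_map f)
    \<and> generalized_1_type_Gauss_map_with 2 (rot_domain I) (rot_hypersurface f) (rot_gauss_map f)
        (\<lambda>u. m (u $ 1)) (\<lambda>u. n (u $ 1)) (vector [C\<^sub>1, 0, 0, 0])"
proof -
  interpret rotational_profile I f
    by unfold_locales (use assms in auto)
  have m: "m s = (2 * f2 s * (f1 s * W s ^ 4 - s * (2 * (f1 s)\<^sup>2 + 1) * f2 s) + s * (W s)\<^sup>2 * f1 s * f3 s)
      / (s ^ 3 * W s ^ 8)" if "s \<in> I" for s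
    unfolding assms(8)[OF that] Let_def by (rule coefficient_eqs(1)[OF that])
  have n: "n s = (s * (W s)\<^sup>2 * f1 s * f3 s
      - (2 * f1 s * (W s)\<^sup>2 + s * (3 * (f1 s)\<^sup>2 + 2) * f2 s) * f2 s) / (C\<^sub>1 * s ^ 3 * W s ^ 7)"
    if "s \<in> I" for s
    unfolding assms(9)[OF that] Let_def coefficient_eqs(2)[OF that] W_square[OF that] ..
  \<comment> \<open>\<open>m\<close> and \<open>n\<close> are prescribed only on \<open>I\<close>;
    since \<open>I\<close> is open, smoothness passes to them from the explicit formulas.\<close>
  have "smooth_on I m" "smooth_on I n"
    using smooth_on_cong[OF open_I smooth_coefficients(1)[OF \<open>C\<^sub>1 \<noteq> 0\<close>] m[symmetric]]
      smooth_on_cong[OF open_I smooth_coefficients(2)[OF \<open>C\<^sub>1 \<noteq> 0\<close>] n[symmetric]] by blast+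
  then have smooth: "smooth_on U (\<lambda>u. m (u $ 1))" "smooth_on U (\<lambda>u. n (u $ 1))"
    by (simp_all add: smooth_on_profile)
  have ex: "\<exists>u\<in>U. h (u $ 1) \<noteq> 0" if "\<exists>s\<in>I. h s \<noteq> 0" for h :: "real \<Rightarrow> real"
  proof -
    from that obtain s where "s \<in> I" "h s \<noteq> 0" by blast
    \<comment> \<open>The choice t = 0 keeps the cosine nonzero, so the point lies in the
      domain.\<close>
    then show ?thesis
      by (intro bexI[of _ "vector [s, 0, 0]"]) (simp_all add: rot_domain_def)
  qed
  have C: "vector [C\<^sub>1, 0, 0, 0] \<noteq> (0 :: real^4)"
    using \<open>C\<^sub>1 \<noteq> 0\<close> by (simp add: vec_eq_iff forall_4)
  have "L_op_vec 2 X N N u = m (u $ 1) *\<^sub>R N u + n (u $ 1) *\<^sub>R vector [C\<^sub>1, 0, 0, 0]" if u: "u \<in> U" for u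
  proof -
    \<comment> \<open>For \<open>i = 1\<close> the factor \<open>C\<^sub>1\<close> cancels the one
      in the denominator of \<open>n\<close>; in the other components the constant vector
      vanishes.\<close>
    have "L_op_vec 2 X N N u $ i = (m (u $ 1) *\<^sub>R N u + n (u $ 1) *\<^sub>R vector [C\<^sub>1, 0, 0, 0]) $ i" for i
      using exhaust_4[of i] \<open>C\<^sub>1 \<noteq> 0\<close>
      by (auto simp: L_op_vec_def L_op_gauss_map_nth[OF u] m[OF U_D(1)[OF u]] n[OF U_D(1)[OF u]])
    then show ?thesis by (simp add: vec_eq_iff)
  qed
  then have "generalized_1_type_Gauss_map_with 2 U X N (\<lambda>u. m (u $ 1)) (\<lambda>u. n (u $ 1)) (vector [C\<^sub>1, 0, 0, 0])"
    unfolding generalized_1_type_Gauss_map_with_def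
    using smooth ex[OF assms(10)] ex[OF assms(11)] C by blast
  then show ?thesis
    using oriented_hypersurface_X unfolding generalized_1_type_Gauss_map_def by blast
qed

end
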